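(* Let $p$ be a prime number, let $\sigma_1,\sigma_2,\sigma_3\in\mathbb{C}$, and put $$\nu_1=\sigma_1-\sigma_2-\sigma_3,\qquad \nu_2=\sigma_2-\sigma_3-\sigma_1,\qquad \nu_3=\sigma_3-\sigma_1-\sigma_2.$$ Define $$ I_{\mathbb{Q}_p}(\sigma_1,\sigma_2,\sigma_3) = \int_{\mathbb{Q}_p^3} \psi_p(x_1)^{-2\sigma_1}\psi_p(x_2)^{-2\sigma_2}\psi_p(x_3)^{-2\sigma_3}\, |x_1 - x_2|_p^{-1-\nu_3}|x_2 - x_3|_p^{-1-\nu_1}|x_3 - x_1|_p^{-1-\nu_2}\, d_px_1\,d_px_2\,d_px_3 $$ and $$ \tilde I_{\mathbb{Q}_p}(\sigma_1,\sigma_2,\sigma_3) = \int_{\mathbb{Q}_p^2} \psi_p(x_1)^{-2\sigma_1}\psi_p(x_2)^{-2\sigma_2}\, |x_1 - x_2|_p^{-1-\nu_3}\, d_px_1\,d_px_2 . $$ Assume that $\sigma_1,\sigma_2,\sigma_3$ are such that these integrals converge absolutely. Then: (i) $$I_{\mathbb{Q}_p}(\sigma_1,\sigma_2,\sigma_3) = \frac{1}{\Gamma_{\mathbb{Q}_p}(2)}\,\tilde I_{\mathbb{Q}_p}(\sigma_1,\sigma_2,\sigma_3);$$ (ii) $$\tilde I_{\mathbb{Q}_p}(\sigma_1,\sigma_2,\sigma_3) = \frac{\Gamma_{\mathbb{Q}_p}(\sigma_1 + \sigma_2 + \sigma_3 - 1)\, \Gamma_{\mathbb{Q}_p}(-\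nu_1)\,\Gamma_{\mathbb{Q}_p}(-\nu_2)\,\Gamma_{\mathbb{Q}_p}(-\nu_3)}{\Gamma_{\mathbb{Q}_p}(2\sigma_1)\,\Gamma_{\mathbb{Q}_p}(2\sigma_2)\,\Gamma_{\mathbb{Q}_p}(2\sigma_3)}.$$
   Context: $\mathbb{Q}_p$ is the field of $p$-adic numbers, $d_px$ is the Haar measure on $\mathbb{Q}_p$ normalized by $\int_{\mathbb{Z}_p}d_px=1$, and $|\cdot|_p$ is the $p$-adic norm with $|p|_p=p^{-1}$, $|0|_p=0$. The function $\psi_p$ on $\mathbb{Q}_p$ is $\psi_p(x)=\max\{|x|_p,1\}$. For $\sigma\in\mathbb{C}$, $\Gamma_{\mathbb{Q}_p}(\sigma)=\frac{1-p^{-1}}{1-p^{-\sigma}}$ (so $1/\Gamma_{\mathbb{Q}_p}(\sigma)=\frac{1-p^{-\sigma}}{1-p^{-1}}$ for all $\sigma\in\mathbb{C}$, being $0$ when $p^{-\sigma}=1$). Complex powers of positive reals are $t^s=e^{s\log t}$ with $\log t$ real. *)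

theory Defs
  imports
    "HOL-Analysis.Analysis"
    "HOL-Computational_Algebra.Primes"
    "HOL-Algebra.QuotRing"
begin

text \<open>
  The field of \<open>p\<close>-adic numbers is constructed as the completion of the rationals: the ring of
  sequences of rationals that are Cauchy for the \<open>p\<close>-adic absolute value, modulo the ideal of
  sequences tending to zero.
\<close>

definition rat_padic_abs :: "nat \<Rightarrow> rat \<Rightarrow> real" where
  "rat_padic_abs p q =
     (if q = 0 then 0
      else case quotient_of q of (a, b) \<Rightarrow>
        real p powi (int (multiplicity (int p) b) - int (multiplicity (int p) a)))"

definition padic_Cauchy :: "nat \<Rightarrow> (nat \<Rightarrow> rat) \<Rightarrow> bool" where
  "padic_Cauchy p X \<longleftrightarrow>
     (\<forall>e>0. \<exists>N. \<forall>m\<ge>N. \<forall>n\<ge>N. rat_padic_abs p (X m - X n) < e)"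

definition padic_Cauchy_ring :: "nat \<Rightarrow> (nat \<Rightarrow> rat) ring" where
  "padic_Cauchy_ring p =
     \<lparr>carrier = {X. padic_Cauchy p X},
      mult = (\<lambda>X Y n. X n * Y n), one = (\<lambda>_. 1),
      zero = (\<lambda>_. 0), add = (\<lambda>X Y n. X n + Y n)\<rparr>"

definition padic_null :: "nat \<Rightarrow> (nat \<Rightarrow> rat) set" where
  "padic_null p = {X. (\<lambda>n. rat_padic_abs p (X n)) \<longlonglongrightarrow> 0}"

type_synonym padic = "(nat \<Rightarrow> rat) set"

definition padic_field :: "nat \<Rightarrow> padic ring" where
  "padic_field p = padic_Cauchy_ring p Quot padic_null p"

text \<open>An element of the field is a class of Cauchy sequences; its absolute value is the common
  limit of the absolute values along any of these sequences.\<close>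

definition padic_norm :: "nat \<Rightarrow> padic \<Rightarrow> real" where
  "padic_norm p x = (THE r. \<forall>X\<in>x. (\<lambda>n. rat_padic_abs p (X n)) \<longlonglongrightarrow> r)"

definition padic_int :: "nat \<Rightarrow> padic set" where
  "padic_int p = {x \<in> carrier (padic_field p). padic_norm p x \<le> 1}"

text \<open>Outside the carrier the distance is set to \<open>0\<close>, because the locale \<^locale>\<open>Metric_space\<close>
  asks for nonnegativity and symmetry on the whole type.\<close>

definition padic_dist :: "nat \<Rightarrow> padic \<Rightarrow> padic \<Rightarrow> real" where
  "padic_dist p x y =
     (if x \<in> carrier (padic_field p) \<and> y \<in> carrier (padic_field p)
      then padic_norm p (x \<ominus>\<^bsub>padic_field p\<^esub> y) else 0)"

definition padic_topology :: "nat \<Rightarrow> padic topology" where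
  "padic_topology p = Metric_space.mtopology (carrier (padic_field p)) (padic_dist p)"

definition padic_borel :: "nat \<Rightarrow> padic measure" where
  "padic_borel p = sigma (carrier (padic_field p)) {U. openin (padic_topology p) U}"

text \<open>The regularity conditions usually imposed on a Haar measure hold automatically here, the
  space being locally compact and second countable. Nontriviality follows from the normalization.\<close>

definition normalized_padic_Haar :: "nat \<Rightarrow> padic measure \<Rightarrow> bool" where
  "normalized_padic_Haar p \<mu> \<longleftrightarrow>
     sets \<mu> = sets (padic_borel p) \<and>
     (\<forall>K. compactin (padic_topology p) K \<longrightarrow> emeasure \<mu> K < \<infinity>) \<and>
     (\<forall>a\<in>carrier (padic_field p). \<forall>A\<in>sets \<mu>.
        emeasure \<mu> ((\<lambda>x. a \<oplus>\<^bsub>padic_field p\<^esub> x) ` A) = emeasure \<mu> A) \<and>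
     emeasure \<mu> (padic_int p) = 1"

definition padic_psi :: "nat \<Rightarrow> padic \<Rightarrow> real" where
  "padic_psi p x = max (padic_norm p x) 1"

definition padic_Gamma :: "nat \<Rightarrow> complex \<Rightarrow> complex" where
  "padic_Gamma p \<sigma> = (1 - 1 / of_nat p) / (1 - of_nat p powr (- \<sigma>))"

text \<open>At a pole, \<open>z / 0 = 0\<close> makes both the function and its reciprocal zero. Hence the
  reciprocal has the intended (entire) values everywhere.\<close>

lemma inverse_padic_Gamma:
  "1 / padic_Gamma p \<sigma> = (1 - of_nat p powr (- \<sigma>)) / (1 - 1 / of_nat p)"
  by (simp add: padic_Gamma_def)

text \<open>In the integrands, \<open>(powr)\<close> on \<^typ>\<open>complex\<close> is \<open>exp (s * Ln t)\<close> for \<open>t \<noteq> 0\<close>, with \<open>Ln t\<close>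
  real for real \<open>t > 0\<close>; \<open>0 powr s = 0\<close> only matters where two of the variables coincide.\<close>

definition I_integrand ::
  "nat \<Rightarrow> complex \<Rightarrow> complex \<Rightarrow> complex \<Rightarrow> padic \<times> padic \<times> padic \<Rightarrow> complex" where
  "I_integrand p \<sigma>\<^sub>1 \<sigma>\<^sub>2 \<sigma>\<^sub>3 = (\<lambda>(x\<^sub>1, x\<^sub>2, x\<^sub>3).
     let \<nu>\<^sub>1 = \<sigma>\<^sub>1 - \<sigma>\<^sub>2 - \<sigma>\<^sub>3; \<nu>\<^sub>2 = \<sigma>\<^sub>2 - \<sigma>\<^sub>3 - \<sigma>\<^sub>1; \<nu>\<^sub>3 = \<sigma>\<^sub>3 - \<sigma>\<^sub>1 - \<sigma>\<^sub>2 in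
       of_real (padic_psi p x\<^sub>1) powr (- 2 * \<sigma>\<^sub>1) *
       of_real (padic_psi p x\<^sub>2) powr (- 2 * \<sigma>\<^sub>2) *
       of_real (padic_psi p x\<^sub>3) powr (- 2 * \<sigma>\<^sub>3) *
       of_real (padic_norm p (x\<^sub>1 \<ominus>\<^bsub>padic_field p\<^esub> x\<^sub>2)) powr (- 1 - \<nu>\<^sub>3) *
       of_real (padic_norm p (x\<^sub>2 \<ominus>\<^bsub>padic_field p\<^esub> x\<^sub>3)) powr (- 1 - \<nu>\<^sub>1) *
       of_real (padic_norm p (x\<^sub>3 \<ominus>\<^bsub>padic_field p\<^esub> x\<^sub>1)) powr (- 1 - \<nu>\<^sub>2))"

definition I_tilde_integrand ::
  "nat \<Rightarrow> complex \<Rightarrow> complex \<Rightarrow> complex \<Rightarrow> padic \<times> padic \<Rightarrow> complex" where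
  "I_tilde_integrand p \<sigma>\<^sub>1 \<sigma>\<^sub>2 \<sigma>\<^sub>3 = (\<lambda>(x\<^sub>1, x\<^sub>2).
     let \<nu>\<^sub>3 = \<sigma>\<^sub>3 - \<sigma>\<^sub>1 - \<sigma>\<^sub>2 in
       of_real (padic_psi p x\<^sub>1) powr (- 2 * \<sigma>\<^sub>1) *
       of_real (padic_psi p x\<^sub>2) powr (- 2 * \<sigma>\<^sub>2) *
       of_real (padic_norm p (x\<^sub>1 \<ominus>\<^bsub>padic_field p\<^esub> x\<^sub>2)) powr (- 1 - \<nu>\<^sub>3))"

definition I_padic ::
  "nat \<Rightarrow> padic measure \<Rightarrow> complex \<Rightarrow> complex \<Rightarrow> complex \<Rightarrow> complex" where
  "I_padic p \<mu> \<sigma>\<^sub>1 \<sigma>\<^sub>2 \<sigma>\<^sub>3 =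
     (\<integral>x. I_integrand p \<sigma>\<^sub>1 \<sigma>\<^sub>2 \<sigma>\<^sub>3 x \<partial>(\<mu> \<Otimes>\<^sub>M \<mu> \<Otimes>\<^sub>M \<mu>))"

definition I_tilde_padic ::
  "nat \<Rightarrow> padic measure \<Rightarrow> complex \<Rightarrow> complex \<Rightarrow> complex \<Rightarrow> complex" where
  "I_tilde_padic p \<mu> \<sigma>\<^sub>1 \<sigma>\<^sub>2 \<sigma>\<^sub>3 =
     (\<integral>x. I_tilde_integrand p \<sigma>\<^sub>1 \<sigma>\<^sub>2 \<sigma>\<^sub>3 x \<partial>(\<mu> \<Otimes>\<^sub>M \<mu>))"

end

theory Submission
  imports Defs
begin

text \<open>
  On the projective line over the \<open>p\<close>-adic numbers consider the spherical ultrametric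
  \<open>|x - y| / (psi x psi y)\<close>, in which \<open>x\<close> has distance \<open>1 / psi x\<close> from the point at infinity, and the
  measure \<open>psi powr - 2\<close> times Haar measure. Every spherical ball of radius \<open>p\<close> to the power \<open>- k\<close> has mass \<open>p\<close> to
  the power \<open>- k\<close> if \<open>k > 0\<close>, and \<open>1 + 1 / p\<close> if \<open>k = 0\<close>, whatever its centre. In these terms the integrand of
  \<open>I\<close> is a product of powers of the three mutual distances of \<open>x\<^sub>1, x\<^sub>2, x\<^sub>3\<close>, and that of \<open>I_tilde\<close> arises from
  it by moving \<open>x\<^sub>3\<close> to infinity. The joint law of the three distances, with one vertex fixed and two
  random ones, depends only on the masses of balls, hence not on the fixed vertex. Integrating over
  that vertex contributes the total mass \<open>1 + 1 / p\<close>, which is (i). Summing geometric series over the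
  joint law gives (ii).
\<close>

section \<open>The p-adic absolute value on the rationals\<close>

text \<open>Behind (i) stands the transitive action of GL_2 of the \<open>p\<close>-adic integers on
  the projective line by isometries. Computed masses of balls stand in for that group: a vertex
  enters the law of triangles only through the masses of the balls around it, so the point at
  infinity can be a vertex without being an element of the type.

  Nothing is assumed of the exponents beyond integrability. As distances are \<open>0\<close> or
  powers of \<open>1 / p\<close>, each integral becomes a series over triples of levels, and
  integrability becomes absolute summability; bounds on the geometric ratios are then read off from
  subseries. These ratios are \<open>p\<close> to the powers \<open>\<nu>\<^sub>1\<close>,
  \<open>\<nu>\<^sub>2\<close>, \<open>\<nu>\<^sub>3\<close> and
  \<open>1 + \<nu>\<^sub>1 + \<nu>\<^sub>2 + \<nu>\<^sub>3\<close>, and give the Gamma factors in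
  the numerator of (ii). The denominator comes from factors \<open>1 - a * b\<close> with two ratios
  \<open>a\<close>, \<open>b\<close>, because two of the \<open>\<nu>\<close> add up to
  \<open>- 2\<close> times one \<open>\<sigma>\<close>.\<close>

lemma rat_padic_abs_divide:
  assumes p: "prime p" and ab: "a \<noteq> 0" "b \<noteq> 0"
  shows "rat_padic_abs p (of_int a / of_int b) =
    real p powi (int (multiplicity (int p) b) - int (multiplicity (int p) a))"
proof -
  define q :: rat where "q = of_int a / of_int b"
  obtain c d where cd: "quotient_of q = (c, d)" by force
  have d: "d > 0" using quotient_of_denom_pos[OF cd] .
  have q: "q = of_int c / of_int d" using quotient_of_div[OF cd] .
  have q0: "q \<noteq> 0" using ab by (simp add: q_def)
  have c: "c \<noteq> 0" using q q0 by auto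
  \<comment> \<open>The definition sees only lowest terms \<open>c / d\<close>; cross-multiplication
    and additivity of \<open>multiplicity\<close> carry the formula over to an arbitrary
    fraction.\<close>
  have "(of_int (a * d) :: rat) = of_int (c * b)"
    using q ab d by (simp add: q_def field_simps)
  hence "a * d = c * b" by (simp only: of_int_eq_iff)
  moreover have "prime_elem (int p)" using p by simp
  ultimately have "multiplicity (int p) a + multiplicity (int p) d =
      multiplicity (int p) c + multiplicity (int p) b"
    using ab c d prime_elem_multiplicity_mult_distrib[of "int p" a d]
      prime_elem_multiplicity_mult_distrib[of "int p" c b] by simp
  hence "int (multiplicity (int p) d) - int (multiplicity (int p) c) =
      int (multiplicity (int p) b) - int (multiplicity (int p) a)" by linarith
  thus ?thesis using q0 cd by (simp add: rat_padic_abs_def q_def[symmetric])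
qed

lemma rat_padic_abs_0 [simp]: "rat_padic_abs p 0 = 0"
  by (simp add: rat_padic_abs_def)

lemma rat_padic_abs_nonneg [simp]: "rat_padic_abs p q \<ge> 0"
  by (auto simp: rat_padic_abs_def split: prod.split)

lemma rat_padic_abs_values: "q \<noteq> 0 \<Longrightarrow> \<exists>k::int. rat_padic_abs p q = real p powi k"
  unfolding rat_padic_abs_def by (simp split: prod.split) blast

lemma rat_as_quotient:
  fixes q :: rat
  obtains a b :: int where "b \<noteq> 0" "q = of_int a / of_int b"
proof -
  obtain a b where ab: "quotient_of q = (a, b)" by force
  show thesis using that[of b a] quotient_of_denom_pos[OF ab] quotient_of_div[OF ab] by simp
qed

lemma rat_padic_abs_mult:
  assumes p: "prime p"
  shows "rat_padic_abs p (x * y) = rat_padic_abs p x * rat_padic_abs p y"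
proof (cases "x = 0 \<or> y = 0")
  case True thus ?thesis by auto
next
  case False
  obtain a b where x: "b \<noteq> 0" "x = of_int a / of_int b" by (rule rat_as_quotient)
  obtain c d where y: "d \<noteq> 0" "y = of_int c / of_int d" by (rule rat_as_quotient)
  have nz: "a \<noteq> 0" "c \<noteq> 0" using False x y by auto
  have pe: "prime_elem (int p)" using p by simp
  have p0: "real p \<noteq> 0" using p by (auto simp: prime_gt_0_nat)
  have "x * y = of_int (a * c) / of_int (b * d)" by (simp add: x y)
  hence "rat_padic_abs p (x * y) = real p powi (int (multiplicity (int p) (b * d)) - int (multiplicity (int p) (a * c)))"
    using rat_padic_abs_divide[OF p, of "a * c" "b * d"] nz x y by simp
  also have "\<dots> = rat_padic_abs p x * rat_padic_abs p y"
    using nz x y p0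
    by (simp add: rat_padic_abs_divide[OF p] prime_elem_multiplicity_mult_distrib[OF pe]
        flip: power_int_add) (simp add: algebra_simps)
  finally show ?thesis .
qed

lemma rat_padic_abs_minus [simp]:
  assumes p: "prime p"
  shows "rat_padic_abs p (- x) = rat_padic_abs p x"
proof -
  have "rat_padic_abs p 1 = 1"
    using rat_padic_abs_divide[OF p, of 1 1] by simp
  moreover have "rat_padic_abs p ((-1) * (-1)) = (rat_padic_abs p (-1))\<^sup>2"
    unfolding power2_eq_square by (rule rat_padic_abs_mult[OF p])
  ultimately have "(rat_padic_abs p (-1))\<^sup>2 = 1" by simp
  hence "rat_padic_abs p (-1) = 1"
    using rat_padic_abs_nonneg[of p "-1"] by (simp add: power2_eq_1_iff)
  thus ?thesis using rat_padic_abs_mult[OF p, of "-1" x] by simp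
qed

text \<open>Over a common denominator \<open>e\<close>, the claim is that \<open>p\<close> to the
  smaller of the two multiplicities divides the sum of the numerators.\<close>

lemma rat_padic_abs_add:
  assumes p: "prime p"
  shows "rat_padic_abs p (x + y) \<le> max (rat_padic_abs p x) (rat_padic_abs p y)"
proof (cases "x = 0 \<or> y = 0 \<or> x + y = 0")
  case True thus ?thesis by (auto simp: le_max_iff_disj)
next
  case False
  obtain a' b where x: "b \<noteq> 0" "x = of_int a' / of_int b" by (rule rat_as_quotient)
  obtain c' d where y: "d \<noteq> 0" "y = of_int c' / of_int d" by (rule rat_as_quotient)
  define a c e where "a = a' * d" "c = c' * b" "e = b * d"
  have e: "e \<noteq> 0" and xa: "x = of_int a / of_int e" and yc: "y = of_int c / of_int e"
    using x y by (auto simp: a_c_e_def)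
  have xy: "x + y = of_int (a + c) / of_int e" by (simp add: xa yc add_divide_distrib)
  have nz: "a \<noteq> 0" "c \<noteq> 0" "a + c \<noteq> 0" using False xa yc xy by auto
  let ?v = "multiplicity (int p)"
  have "int p ^ min (?v a) (?v c) dvd a + c"
    by (intro dvd_add; rule multiplicity_dvd') auto
  hence v: "min (?v a) (?v c) \<le> ?v (a + c)"
    using nz p by (intro multiplicity_geI) auto
  have p1: "real p \<ge> 1" using prime_ge_1_nat[OF p] by simp
  show ?thesis
    unfolding xy unfolding xa yc rat_padic_abs_divide[OF p nz(1) e] rat_padic_abs_divide[OF p nz(2) e]
      rat_padic_abs_divide[OF p nz(3) e] le_max_iff_disj
    using v by (auto simp: min_def split: if_splits intro!: power_int_increasing p1)
qed

lemma rat_padic_abs_minus_commute: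
  "prime p \<Longrightarrow> rat_padic_abs p (x - y) = rat_padic_abs p (y - x)"
  using rat_padic_abs_minus[of p "x - y"] by simp

lemma rat_padic_abs_diff:
  assumes p: "prime p"
  shows "rat_padic_abs p (x - y) \<le> max (rat_padic_abs p x) (rat_padic_abs p y)"
  using rat_padic_abs_add[OF p, of x "-y"] rat_padic_abs_minus[OF p] by simp

lemma rat_padic_abs_triangle:
  assumes p: "prime p"
  shows "rat_padic_abs p (x + y) \<le> rat_padic_abs p x + rat_padic_abs p y"
  using rat_padic_abs_add[OF p, of x y] rat_padic_abs_nonneg[of p x] rat_padic_abs_nonneg[of p y] by linarith

lemma rat_padic_abs_triangle_rev:
  assumes p: "prime p"
  shows "\<bar>rat_padic_abs p x - rat_padic_abs p y\<bar> \<le> rat_padic_abs p (x - y)"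
proof -
  have "rat_padic_abs p x \<le> rat_padic_abs p (x - y) + rat_padic_abs p y"
    using rat_padic_abs_triangle[OF p, of "x - y" y] by simp
  moreover have "rat_padic_abs p y \<le> rat_padic_abs p (y - x) + rat_padic_abs p x"
    using rat_padic_abs_triangle[OF p, of "y - x" x] by simp
  ultimately show ?thesis using rat_padic_abs_minus_commute[OF p, of x y] by linarith
qed

text \<open>The isosceles principle. In \<open>norm_values\<close> it makes the absolute values
  along a non-null Cauchy sequence eventually constant.\<close>

lemma rat_padic_abs_eqI:
  assumes p: "prime p" and "rat_padic_abs p (x - y) < rat_padic_abs p x"
  shows "rat_padic_abs p y = rat_padic_abs p x"
  using rat_padic_abs_add[OF p, of "x - y" y] rat_padic_abs_diff[OF p, of x "x - y"] assms(2)
  by (simp add: max_def split: if_splits)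

section \<open>The field of p-adic numbers\<close>

lemma padic_Cauchy_convergent:
  assumes p: "prime p" and X: "padic_Cauchy p X"
  shows "convergent (\<lambda>n. rat_padic_abs p (X n))"
proof -
  have "Cauchy (\<lambda>n. rat_padic_abs p (X n))"
    unfolding Cauchy_def dist_real_def
    using X unfolding padic_Cauchy_def by (meson rat_padic_abs_triangle_rev[OF p] le_less_trans)
  thus ?thesis by (rule Cauchy_convergent)
qed

lemma padic_Cauchy_bounded:
  assumes p: "prime p" and X: "padic_Cauchy p X"
  obtains B where "B > 0" "\<And>n. rat_padic_abs p (X n) \<le> B"
  using convergent_imp_Bseq[OF padic_Cauchy_convergent[OF assms]]
  by (auto simp: Bseq_def)

lemma padic_Cauchy_const: "padic_Cauchy p (\<lambda>_. q)"
  by (simp add: padic_Cauchy_def)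

lemma padic_Cauchy_add:
  assumes p: "prime p" and X: "padic_Cauchy p X" and Y: "padic_Cauchy p Y"
  shows "padic_Cauchy p (\<lambda>n. X n + Y n)"
  unfolding padic_Cauchy_def
proof (intro allI impI)
  fix e :: real assume e: "e > 0"
  obtain N M where N: "\<And>m n. m \<ge> N \<Longrightarrow> n \<ge> N \<Longrightarrow> rat_padic_abs p (X m - X n) < e"
    and M: "\<And>m n. m \<ge> M \<Longrightarrow> n \<ge> M \<Longrightarrow> rat_padic_abs p (Y m - Y n) < e"
    using X Y e unfolding padic_Cauchy_def by meson
  have "rat_padic_abs p ((X m + Y m) - (X n + Y n)) < e" if "m \<ge> max N M" "n \<ge> max N M" for m n
    using rat_padic_abs_add[OF p, of "X m - X n" "Y m - Y n"] N[of m n] M[of m n] that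
    by (simp add: algebra_simps)
  thus "\<exists>N. \<forall>m\<ge>N. \<forall>n\<ge>N. rat_padic_abs p ((X m + Y m) - (X n + Y n)) < e" by blast
qed

lemma padic_Cauchy_minus:
  assumes p: "prime p" and X: "padic_Cauchy p X"
  shows "padic_Cauchy p (\<lambda>n. - X n)"
proof -
  have "rat_padic_abs p (- X m - - X n) = rat_padic_abs p (X m - X n)" for m n
    using rat_padic_abs_minus[OF p, of "X m - X n"] by (simp add: algebra_simps)
  thus ?thesis using X by (simp add: padic_Cauchy_def)
qed

lemma padic_Cauchy_diff:
  assumes p: "prime p" and X: "padic_Cauchy p X" and Y: "padic_Cauchy p Y"
  shows "padic_Cauchy p (\<lambda>n. X n - Y n)"
  using padic_Cauchy_add[OF p X padic_Cauchy_minus[OF p Y]] by simp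

lemma padic_Cauchy_mult:
  assumes p: "prime p" and X: "padic_Cauchy p X" and Y: "padic_Cauchy p Y"
  shows "padic_Cauchy p (\<lambda>n. X n * Y n)"
  unfolding padic_Cauchy_def
proof (intro allI impI)
  fix e :: real assume e: "e > 0"
  obtain B where B: "B > 0" "\<And>n. rat_padic_abs p (X n) \<le> B"
    using padic_Cauchy_bounded[OF p X] by blast
  obtain C where C: "C > 0" "\<And>n. rat_padic_abs p (Y n) \<le> C"
    using padic_Cauchy_bounded[OF p Y] by blast
  have e': "e / C > 0" "e / B > 0" using e B C by auto
  obtain N M where N: "\<And>m n. m \<ge> N \<Longrightarrow> n \<ge> N \<Longrightarrow> rat_padic_abs p (X m - X n) < e / C"
    and M: "\<And>m n. m \<ge> M \<Longrightarrow> n \<ge> M \<Longrightarrow> rat_padic_abs p (Y m - Y n) < e / B"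
    using X Y e' unfolding padic_Cauchy_def by meson
  have "rat_padic_abs p (X m * Y m - X n * Y n) < e" if "m \<ge> max N M" "n \<ge> max N M" for m n
  proof -
    have "X m * Y m - X n * Y n = (X m - X n) * Y m + X n * (Y m - Y n)"
      by (simp add: algebra_simps)
    moreover have "rat_padic_abs p ((X m - X n) * Y m) < e"
    proof -
      have "rat_padic_abs p ((X m - X n) * Y m) \<le> rat_padic_abs p (X m - X n) * C"
        using C(2)[of m] by (simp add: rat_padic_abs_mult[OF p] mult_left_mono)
      also have "\<dots> < e" using N[of m n] that C(1) by (simp add: field_simps)
      finally show ?thesis .
    qed
    moreover have "rat_padic_abs p (X n * (Y m - Y n)) < e"
    proof -
      have "rat_padic_abs p (X n * (Y m - Y n)) \<le> B * rat_padic_abs p (Y m - Y n)"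
        using B(2)[of n] by (simp add: rat_padic_abs_mult[OF p] mult_right_mono)
      also have "\<dots> < e" using M[of m n] that B(1) by (simp add: field_simps)
      finally show ?thesis .
    qed
    ultimately show ?thesis
      using rat_padic_abs_add[OF p, of "(X m - X n) * Y m" "X n * (Y m - Y n)"] by simp
  qed
  thus "\<exists>N. \<forall>m\<ge>N. \<forall>n\<ge>N. rat_padic_abs p (X m * Y m - X n * Y n) < e" by blast
qed

lemma padic_null_imp_Cauchy:
  assumes p: "prime p" and X: "X \<in> padic_null p"
  shows "padic_Cauchy p X"
  unfolding padic_Cauchy_def
proof (intro allI impI)
  fix e :: real assume "e > 0"
  then obtain N where N: "\<And>n. n \<ge> N \<Longrightarrow> rat_padic_abs p (X n) < e"
    using X LIMSEQ_D[of _ 0 e] unfolding padic_null_def by fastforce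
  thus "\<exists>N. \<forall>m\<ge>N. \<forall>n\<ge>N. rat_padic_abs p (X m - X n) < e"
    using rat_padic_abs_diff[OF p] by (metis le_less_trans max_less_iff_conj)
qed

lemma padic_null_add:
  assumes p: "prime p" and X: "X \<in> padic_null p" and Y: "Y \<in> padic_null p"
  shows "(\<lambda>n. X n + Y n) \<in> padic_null p"
proof -
  have "(\<lambda>n. rat_padic_abs p (X n) + rat_padic_abs p (Y n)) \<longlonglongrightarrow> 0"
    using tendsto_add[of _ 0 _ _ 0] X Y by (simp add: padic_null_def)
  hence "(\<lambda>n. rat_padic_abs p (X n + Y n)) \<longlonglongrightarrow> 0"
    by (rule Lim_null_comparison[rotated]) (simp add: rat_padic_abs_triangle[OF p])
  thus ?thesis by (simp add: padic_null_def)
qed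

lemma padic_null_mult:
  assumes p: "prime p" and X: "X \<in> padic_null p" and Y: "padic_Cauchy p Y"
  shows "(\<lambda>n. X n * Y n) \<in> padic_null p"
proof -
  obtain C where C: "C > 0" "\<And>n. rat_padic_abs p (Y n) \<le> C"
    using padic_Cauchy_bounded[OF p Y] by blast
  have "(\<lambda>n. rat_padic_abs p (X n) * C) \<longlonglongrightarrow> 0"
    using tendsto_mult_right[of _ 0 _ C] X by (simp add: padic_null_def)
  hence "(\<lambda>n. rat_padic_abs p (X n * Y n)) \<longlonglongrightarrow> 0"
    by (rule Lim_null_comparison[rotated]) (use C in \<open>simp add: rat_padic_abs_mult[OF p] mult_left_mono\<close>)
  thus ?thesis by (simp add: padic_null_def)
qed

lemma padic_Cauchy_ring_simps [simp]:
  "carrier (padic_Cauchy_ring p) = {X. padic_Cauchy p X}"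
  "mult (padic_Cauchy_ring p) = (\<lambda>X Y n. X n * Y n)"
  "one (padic_Cauchy_ring p) = (\<lambda>_. 1)"
  "zero (padic_Cauchy_ring p) = (\<lambda>_. 0)"
  "add (padic_Cauchy_ring p) = (\<lambda>X Y n. X n + Y n)"
  by (simp_all add: padic_Cauchy_ring_def)

lemma padic_Cauchy_ring_cring:
  assumes p: "prime p"
  shows "cring (padic_Cauchy_ring p)"
proof (intro cringI abelian_groupI comm_monoidI)
  fix X assume "X \<in> carrier (padic_Cauchy_ring p)"
  thus "\<exists>Y\<in>carrier (padic_Cauchy_ring p). Y \<oplus>\<^bsub>padic_Cauchy_ring p\<^esub> X = \<zero>\<^bsub>padic_Cauchy_ring p\<^esub>"
    using padic_Cauchy_minus[OF p] by (intro bexI[of _ "\<lambda>n. - X n"]) auto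
qed (auto simp: padic_Cauchy_add[OF p] padic_Cauchy_mult[OF p] padic_Cauchy_const algebra_simps)

lemma padic_Cauchy_ring_a_inv:
  assumes p: "prime p" and X: "padic_Cauchy p X"
  shows "\<ominus>\<^bsub>padic_Cauchy_ring p\<^esub> X = (\<lambda>n. - X n)"
proof -
  interpret cring "padic_Cauchy_ring p" by (rule padic_Cauchy_ring_cring[OF p])
  show ?thesis using X padic_Cauchy_minus[OF p X] by (intro minus_equality) auto
qed

lemma padic_null_ideal:
  assumes p: "prime p"
  shows "ideal (padic_null p) (padic_Cauchy_ring p)"
proof -
  interpret R: cring "padic_Cauchy_ring p" by (rule padic_Cauchy_ring_cring[OF p])
  show ?thesis
  proof (rule idealI)
    show "ring (padic_Cauchy_ring p)" by (rule R.ring_axioms)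
    have "\<ominus>\<^bsub>padic_Cauchy_ring p\<^esub> X \<in> padic_null p" if X: "X \<in> padic_null p" for X
      using X padic_Cauchy_ring_a_inv[OF p padic_null_imp_Cauchy[OF p X]]
      by (simp add: padic_null_def rat_padic_abs_minus[OF p])
    moreover have "(\<lambda>_. 0) \<in> padic_null p" by (simp add: padic_null_def)
    ultimately show "subgroup (padic_null p) (add_monoid (padic_Cauchy_ring p))"
      using padic_null_add[OF p] padic_null_imp_Cauchy[OF p]
      by (intro R.add.subgroupI) auto
  qed (use padic_null_mult[OF p] in \<open>auto simp: mult.commute\<close>)
qed

locale padic_numbers =
  fixes p :: nat
  assumes prime_p: "prime p"
begin

abbreviation Qp :: "padic ring" where "Qp \<equiv> padic_field p"
abbreviation norm_p :: "padic \<Rightarrow> real" where "norm_p \<equiv> padic_norm p"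

definition cls :: "(nat \<Rightarrow> rat) \<Rightarrow> padic" where
  "cls X = padic_null p +>\<^bsub>padic_Cauchy_ring p\<^esub> X"

sublocale Qp: cring "padic_field p"
  unfolding padic_field_def
  using ideal.quotient_is_cring padic_null_ideal padic_Cauchy_ring_cring prime_p by blast

lemma p_gt_1: "real p > 1"
  using prime_gt_1_nat[OF prime_p] by simp

lemma cls_hom: "ring_hom_ring (padic_Cauchy_ring p) (padic_field p) cls"
  using ideal.rcos_ring_hom_ring[OF padic_null_ideal[OF prime_p]]
  by (simp add: padic_field_def cls_def[abs_def])

lemma carrier_Qp: "carrier Qp = {cls X | X. padic_Cauchy p X}"
  by (auto simp: padic_field_def FactRing_def A_RCOSETS_def' cls_def)

lemma cls_in_carrier [simp]: "padic_Cauchy p X \<Longrightarrow> cls X \<in> carrier Qp"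
  by (auto simp: carrier_Qp)

lemma cls_add:
  "padic_Cauchy p X \<Longrightarrow> padic_Cauchy p Y \<Longrightarrow> cls X \<oplus>\<^bsub>Qp\<^esub> cls Y = cls (\<lambda>n. X n + Y n)"
  using ring_hom_ring.homh[OF cls_hom] by (simp add: ring_hom_def)

lemma cls_diff:
  assumes X: "padic_Cauchy p X" and Y: "padic_Cauchy p Y"
  shows "cls X \<ominus>\<^bsub>Qp\<^esub> cls Y = cls (\<lambda>n. X n - Y n)"
proof -
  interpret h: ring_hom_ring "padic_Cauchy_ring p" "padic_field p" cls by (rule cls_hom)
  have "\<ominus>\<^bsub>Qp\<^esub> cls Y = cls (\<lambda>n. - Y n)"
    using h.hom_a_inv[of Y] Y by (simp add: padic_Cauchy_ring_a_inv[OF prime_p])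
  thus ?thesis
    using X Y cls_add[OF X padic_Cauchy_minus[OF prime_p Y]] by (simp add: a_minus_def)
qed

lemma mem_cls_iff: "Y \<in> cls X \<longleftrightarrow> (\<lambda>n. Y n - X n) \<in> padic_null p"
  by (auto simp: cls_def a_r_coset_def' fun_eq_iff intro!: bexI[of _ "\<lambda>n. Y n - X n"])

lemma cls_self: "X \<in> cls X"
  by (simp add: mem_cls_iff padic_null_def)

text \<open>The definite description in \<open>padic_norm\<close> is well posed: representatives of
  a class differ by a null sequence, so by the reverse triangle inequality their absolute values
  have the same limit.\<close>

lemma norm_cls:
  assumes X: "padic_Cauchy p X" and r: "(\<lambda>n. rat_padic_abs p (X n)) \<longlonglongrightarrow> r"
  shows "norm_p (cls X) = r"
  unfolding padic_norm_def
proof (rule the_equality)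
  show "\<forall>Y\<in>cls X. (\<lambda>n. rat_padic_abs p (Y n)) \<longlonglongrightarrow> r"
  proof
    fix Y assume "Y \<in> cls X"
    hence "(\<lambda>n. rat_padic_abs p (Y n - X n)) \<longlonglongrightarrow> 0"
      by (simp add: mem_cls_iff padic_null_def)
    hence "(\<lambda>n. rat_padic_abs p (Y n) - rat_padic_abs p (X n)) \<longlonglongrightarrow> 0"
      by (rule Lim_null_comparison[rotated]) (simp add: rat_padic_abs_triangle_rev[OF prime_p])
    from tendsto_add[OF this r] show "(\<lambda>n. rat_padic_abs p (Y n)) \<longlonglongrightarrow> r" by simp
  qed
next
  fix s assume "\<forall>Y\<in>cls X. (\<lambda>n. rat_padic_abs p (Y n)) \<longlonglongrightarrow> s"
  thus "s = r" using cls_self r LIMSEQ_unique by blast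
qed

lemma norm_cls_tendsto:
  "padic_Cauchy p X \<Longrightarrow> (\<lambda>n. rat_padic_abs p (X n)) \<longlonglongrightarrow> norm_p (cls X)"
  using padic_Cauchy_convergent[OF prime_p] norm_cls by (metis convergent_def)

lemma norm_nonneg:
  assumes "x \<in> carrier Qp" shows "norm_p x \<ge> 0"
proof -
  obtain X where X: "padic_Cauchy p X" "x = cls X" using assms by (auto simp: carrier_Qp)
  show ?thesis unfolding X(2) by (rule LIMSEQ_le_const[OF norm_cls_tendsto[OF X(1)]]) auto
qed

lemma norm_add:
  assumes "x \<in> carrier Qp" "y \<in> carrier Qp"
  shows "norm_p (x \<oplus>\<^bsub>Qp\<^esub> y) \<le> max (norm_p x) (norm_p y)"
proof -
  obtain X where X: "padic_Cauchy p X" "x = cls X" using assms by (auto simp: carrier_Qp)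
  obtain Y where Y: "padic_Cauchy p Y" "y = cls Y" using assms by (auto simp: carrier_Qp)
  have 1: "(\<lambda>n. rat_padic_abs p (X n + Y n)) \<longlonglongrightarrow> norm_p (x \<oplus>\<^bsub>Qp\<^esub> y)"
    using norm_cls_tendsto[OF padic_Cauchy_add[OF prime_p X(1) Y(1)]] X Y by (simp add: cls_add)
  have 2: "(\<lambda>n. max (rat_padic_abs p (X n)) (rat_padic_abs p (Y n))) \<longlonglongrightarrow> max (norm_p x) (norm_p y)"
    using X Y norm_cls_tendsto by (intro tendsto_max) auto
  show ?thesis by (rule LIMSEQ_le[OF 1 2]) (use rat_padic_abs_add[OF prime_p] in blast)
qed

lemma norm_minus_commute:
  assumes "x \<in> carrier Qp" "y \<in> carrier Qp"
  shows "norm_p (x \<ominus>\<^bsub>Qp\<^esub> y) = norm_p (y \<ominus>\<^bsub>Qp\<^esub> x)"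
proof -
  obtain X where X: "padic_Cauchy p X" "x = cls X" using assms by (auto simp: carrier_Qp)
  obtain Y where Y: "padic_Cauchy p Y" "y = cls Y" using assms by (auto simp: carrier_Qp)
  have "(\<lambda>n. rat_padic_abs p (X n - Y n)) \<longlonglongrightarrow> norm_p (x \<ominus>\<^bsub>Qp\<^esub> y)"
    using norm_cls_tendsto[OF padic_Cauchy_diff[OF prime_p X(1) Y(1)]] X Y by (simp add: cls_diff)
  moreover have "(\<lambda>n. rat_padic_abs p (X n - Y n)) \<longlonglongrightarrow> norm_p (y \<ominus>\<^bsub>Qp\<^esub> x)"
    using norm_cls_tendsto[OF padic_Cauchy_diff[OF prime_p Y(1) X(1)]] X Y
    by (simp add: cls_diff rat_padic_abs_minus_commute[OF prime_p, of "X _" "Y _"])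
  ultimately show ?thesis by (rule LIMSEQ_unique)
qed

lemma norm_diff_eq_0_iff:
  assumes "x \<in> carrier Qp" "y \<in> carrier Qp"
  shows "norm_p (x \<ominus>\<^bsub>Qp\<^esub> y) = 0 \<longleftrightarrow> x = y"
proof -
  obtain X where X: "padic_Cauchy p X" "x = cls X" using assms by (auto simp: carrier_Qp)
  obtain Y where Y: "padic_Cauchy p Y" "y = cls Y" using assms by (auto simp: carrier_Qp)
  interpret I: ideal "padic_null p" "padic_Cauchy_ring p" by (rule padic_null_ideal[OF prime_p])
  have "(\<lambda>n. rat_padic_abs p (X n - Y n)) \<longlonglongrightarrow> norm_p (x \<ominus>\<^bsub>Qp\<^esub> y)"
    using norm_cls_tendsto[OF padic_Cauchy_diff[OF prime_p X(1) Y(1)]] X Y by (simp add: cls_diff)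
  hence "norm_p (x \<ominus>\<^bsub>Qp\<^esub> y) = 0 \<longleftrightarrow> (\<lambda>n. X n - Y n) \<in> padic_null p"
    unfolding padic_null_def using LIMSEQ_unique by auto
  also have "\<dots> \<longleftrightarrow> X \<in> cls Y" by (simp add: mem_cls_iff)
  also have "\<dots> \<longleftrightarrow> cls X = cls Y"
    using I.a_repr_independence'[of X Y] cls_self X Y by (auto simp: cls_def)
  finally show ?thesis using X Y by simp
qed

text \<open>If the limit \<open>r\<close> is nonzero, the absolute values are eventually constant:
  the one at \<open>m\<close> exceeds \<open>r / 2\<close>, while later differences stay below
  \<open>r / 2\<close>. The limit is then the absolute value of a nonzero rational.\<close>

lemma norm_values:
  assumes "x \<in> carrier Qp"
  shows "norm_p x = 0 \<or> (\<exists>k::int. norm_p x = real p powi k)"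
proof (rule disjCI)
  assume nk: "\<not> (\<exists>k::int. norm_p x = real p powi k)"
  obtain X where X: "padic_Cauchy p X" "x = cls X" using assms by (auto simp: carrier_Qp)
  define r where "r = norm_p x"
  have r: "(\<lambda>n. rat_padic_abs p (X n)) \<longlonglongrightarrow> r" using norm_cls_tendsto X by (simp add: r_def)
  show "norm_p x = 0"
  proof (rule ccontr)
    assume "norm_p x \<noteq> 0"
    hence r0: "r > 0" using norm_nonneg[OF assms] by (simp add: r_def)
    obtain N where N: "\<And>n. n \<ge> N \<Longrightarrow> \<bar>rat_padic_abs p (X n) - r\<bar> < r / 2"
      using LIMSEQ_D[OF r, of "r/2"] r0 by auto
    obtain M where M: "\<And>m n. m \<ge> M \<Longrightarrow> n \<ge> M \<Longrightarrow> rat_padic_abs p (X m - X n) < r / 2"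
      using X(1) r0 unfolding padic_Cauchy_def by (meson half_gt_zero)
    define m where "m = max M N"
    have m: "rat_padic_abs p (X m) > r / 2" using N[of m] unfolding m_def by linarith
    have "rat_padic_abs p (X n) = rat_padic_abs p (X m)" if "n \<ge> m" for n
      using M[of m n] that m by (intro rat_padic_abs_eqI[OF prime_p]) (auto simp: m_def)
    hence "(\<lambda>n. rat_padic_abs p (X n)) \<longlonglongrightarrow> rat_padic_abs p (X m)"
      by (intro tendsto_eventually eventually_sequentiallyI[of m])
    with r have "r = rat_padic_abs p (X m)" by (rule LIMSEQ_unique)
    moreover have "X m \<noteq> 0" using m r0 by auto
    ultimately show False using nk rat_padic_abs_values[of "X m" p] by (simp add: r_def)
  qed
qed

definition of_rat_p :: "rat \<Rightarrow> padic" where "of_rat_p q = cls (\<lambda>_. q)"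

lemma of_rat_p_carrier [simp]: "of_rat_p q \<in> carrier Qp"
  by (simp add: of_rat_p_def padic_Cauchy_const)

lemma norm_of_rat_p_diff: "norm_p (of_rat_p a \<ominus>\<^bsub>Qp\<^esub> of_rat_p b) = rat_padic_abs p (a - b)"
  unfolding of_rat_p_def
  by (simp add: cls_diff padic_Cauchy_const) (intro norm_cls padic_Cauchy_const tendsto_const)

lemma of_rat_p_dense:
  assumes "x \<in> carrier Qp" "e > 0"
  shows "\<exists>q. norm_p (x \<ominus>\<^bsub>Qp\<^esub> of_rat_p q) < e"
proof -
  obtain X where X: "padic_Cauchy p X" "x = cls X" using assms by (auto simp: carrier_Qp)
  \<comment> \<open>Half of \<open>e\<close>, because the limit over \<open>m\<close> weakens the
    strict bound to a non-strict one.\<close>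
  obtain N where N: "\<And>m n. m \<ge> N \<Longrightarrow> n \<ge> N \<Longrightarrow> rat_padic_abs p (X m - X n) < e / 2"
    using X(1) assms(2) unfolding padic_Cauchy_def by (meson half_gt_zero)
  have "(\<lambda>n. rat_padic_abs p (X n - X N)) \<longlonglongrightarrow> norm_p (x \<ominus>\<^bsub>Qp\<^esub> of_rat_p (X N))"
    using norm_cls_tendsto[OF padic_Cauchy_diff[OF prime_p X(1) padic_Cauchy_const]] X
    by (simp add: of_rat_p_def cls_diff padic_Cauchy_const)
  hence "norm_p (x \<ominus>\<^bsub>Qp\<^esub> of_rat_p (X N)) \<le> e / 2"
    by (rule LIMSEQ_le_const2) (use N in \<open>auto intro!: exI[of _ N] less_imp_le\<close>)
  thus ?thesis using assms(2) by (intro exI[of _ "X N"]) linarith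
qed

end

section \<open>Residue digits, subdivision of balls, and the ultrametric topology\<close>

lemma rat_padic_abs_of_nat_p:
  assumes p: "prime p" shows "rat_padic_abs p (of_nat p powi k) = real p powi (- k)"
proof -
  have p0: "p > 0" using prime_gt_0_nat[OF p] .
  have pp: "rat_padic_abs p (of_nat p ^ n) = real p powi (- int n)" for n
    using rat_padic_abs_divide[OF p, of "int p ^ n" 1] p p0
    by (simp add: multiplicity_same_power not_prime_0)
  have nz: "rat_padic_abs p 1 = 1" using rat_padic_abs_divide[OF p, of 1 1] by simp
  show ?thesis
  proof (cases "k \<ge> 0")
    case True thus ?thesis using pp[of "nat k"] by (simp add: power_int_def)
  next
    case False
    define n where "n = nat (- k)"
    have k: "k = - int n" using False by (simp add: n_def)
    have "rat_padic_abs p (of_nat p powi k) * rat_padic_abs p (of_nat p ^ n) = 1"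
      unfolding rat_padic_abs_mult[OF p, symmetric] k using p0 nz by (simp add: power_int_minus)
    thus ?thesis using p0 unfolding pp by (simp add: k power_int_minus field_simps)
  qed
qed

text \<open>In lowest terms \<open>a / b\<close>, absolute value at most \<open>1\<close> means that
  \<open>p\<close> does not divide \<open>b\<close>. Bezout gives an inverse \<open>u\<close> of
  \<open>b\<close> modulo \<open>p\<close>, and the digit is \<open>a * u\<close> modulo
  \<open>p\<close>.\<close>

lemma rat_padic_residue:
  assumes p: "prime p" and r: "rat_padic_abs p r \<le> 1"
  shows "\<exists>d<p. rat_padic_abs p (r - of_nat d) \<le> 1 / real p"
proof -
  obtain a b where ab: "quotient_of r = (a, b)" by force
  have b: "b > 0" and q: "r = of_int a / of_int b" and co: "coprime a b"
    using quotient_of_denom_pos[OF ab] quotient_of_div[OF ab] quotient_of_coprime[OF ab] by auto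
  have p1: "real p > 1" using prime_gt_1_nat[OF p] by simp
  have pu: "\<not> is_unit (int p)" using p1 by simp
  have nb: "\<not> int p dvd b"
  proof
    assume pb: "int p dvd b"
    hence na: "\<not> int p dvd a" using co pu by (meson coprime_def)
    hence a0: "a \<noteq> 0" by auto
    have "multiplicity (int p) b \<ge> 1" using pb b pu by (intro multiplicity_geI) auto
    moreover have "multiplicity (int p) a = 0" using na by (rule not_dvd_imp_multiplicity_0)
    ultimately have "rat_padic_abs p r > 1"
      unfolding q rat_padic_abs_divide[OF p a0 less_imp_neq[OF b, symmetric]]
      using p1 by (intro one_less_power_int) auto
    thus False using r by simp
  qed
  have "coprime (int p) b" using p nb by (intro prime_imp_coprime) auto
  then obtain u v where uv: "u * b + v * int p = 1"
    using bezout_int[of b "int p"] by (auto simp: coprime_commute)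
  define d where "d = (a * u) mod int p"
  have d: "0 \<le> d" "d < int p" using p1 by (auto simp: d_def)
  have "a - d * b = a * (1 - u * b) + ((a * u) div int p) * int p * b"
    unfolding d_def minus_div_mult_eq_mod[symmetric] by (simp add: algebra_simps)
  also have "1 - u * b = v * int p" using uv by simp
  finally have dvd: "int p dvd a - d * b" by simp
  have "rat_padic_abs p (r - of_int d) \<le> 1 / real p"
  proof (cases "a - d * b = 0")
    case True
    hence "a = d * b" by simp
    hence "r = of_int d" using b by (simp add: q)
    thus ?thesis by simp
  next
    case False
    have "r - of_int d = of_int (a - d * b) / of_int b" using b by (simp add: q field_simps)
    hence "rat_padic_abs p (r - of_int d) = real p powi (int (multiplicity (int p) b) - int (multiplicity (int p) (a - d * b)))"
      using rat_padic_abs_divide[OF p False less_imp_neq[OF b, symmetric]] by simp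
    also have "multiplicity (int p) b = 0" using nb by (rule not_dvd_imp_multiplicity_0)
    also have "real p powi (int 0 - int (multiplicity (int p) (a - d * b))) \<le> real p powi (-1)"
    proof -
      have "multiplicity (int p) (a - d * b) \<ge> 1" using dvd False pu by (intro multiplicity_geI) auto
      thus ?thesis using p1 by (intro power_int_increasing) auto
    qed
    finally show ?thesis by (simp add: power_int_minus field_simps)
  qed
  thus ?thesis using d by (intro exI[of _ "nat d"]) auto
qed

lemma rat_padic_abs_of_int_unit:
  assumes p: "prime p" and "\<not> int p dvd d"
  shows "rat_padic_abs p (of_int d) = 1"
proof -
  have "d \<noteq> 0" using assms by auto
  thus ?thesis
    using rat_padic_abs_divide[OF p, of d 1] not_dvd_imp_multiplicity_0[OF assms(2)] by simp
qed

context padic_numbers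
begin

definition D :: "padic \<Rightarrow> padic \<Rightarrow> real" where
  "D x y = norm_p (x \<ominus>\<^bsub>Qp\<^esub> y)"

lemma D_nonneg: "x \<in> carrier Qp \<Longrightarrow> y \<in> carrier Qp \<Longrightarrow> D x y \<ge> 0"
  by (simp add: D_def norm_nonneg)

lemma D_commute: "x \<in> carrier Qp \<Longrightarrow> y \<in> carrier Qp \<Longrightarrow> D x y = D y x"
  by (simp add: D_def norm_minus_commute)

lemma D_eq_0_iff: "x \<in> carrier Qp \<Longrightarrow> y \<in> carrier Qp \<Longrightarrow> D x y = 0 \<longleftrightarrow> x = y"
  by (simp add: D_def norm_diff_eq_0_iff)

lemma D_self [simp]: "x \<in> carrier Qp \<Longrightarrow> D x x = 0"
  by (simp add: D_eq_0_iff)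

lemma D_values: "x \<in> carrier Qp \<Longrightarrow> y \<in> carrier Qp \<Longrightarrow> D x y = 0 \<or> (\<exists>k::int. D x y = real p powi k)"
  by (simp add: D_def norm_values)

lemma D_ultrametric:
  assumes "x \<in> carrier Qp" "y \<in> carrier Qp" "z \<in> carrier Qp"
  shows "D x z \<le> max (D x y) (D y z)"
proof -
  have "x \<ominus>\<^bsub>Qp\<^esub> z = (x \<ominus>\<^bsub>Qp\<^esub> y) \<oplus>\<^bsub>Qp\<^esub> (y \<ominus>\<^bsub>Qp\<^esub> z)" using assms by algebra
  thus ?thesis using assms by (simp add: D_def norm_add)
qed

lemma D_translate:
  assumes "x \<in> carrier Qp" "y \<in> carrier Qp" "a \<in> carrier Qp"
  shows "D (a \<oplus>\<^bsub>Qp\<^esub> x) (a \<oplus>\<^bsub>Qp\<^esub> y) = D x y"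
proof -
  have "(a \<oplus>\<^bsub>Qp\<^esub> x) \<ominus>\<^bsub>Qp\<^esub> (a \<oplus>\<^bsub>Qp\<^esub> y) = x \<ominus>\<^bsub>Qp\<^esub> y" using assms by algebra
  thus ?thesis by (simp add: D_def)
qed

lemma D_zero: "x \<in> carrier Qp \<Longrightarrow> D x \<zero>\<^bsub>Qp\<^esub> = norm_p x"
  by (simp add: D_def a_minus_def)

lemma of_rat_p_0: "of_rat_p 0 = \<zero>\<^bsub>Qp\<^esub>"
proof -
  interpret h: ring_hom_ring "padic_Cauchy_ring p" "padic_field p" cls by (rule cls_hom)
  show ?thesis using h.hom_zero by (simp add: of_rat_p_def)
qed

lemma D_of_rat_p: "D (of_rat_p a) (of_rat_p b) = rat_padic_abs p (a - b)"
  by (simp add: D_def norm_of_rat_p_diff)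

lemma p_powi_arbitrarily_small:
  assumes "e > 0" obtains k :: nat where "real p powi (- int k) < e"
proof -
  obtain k where "(1 / real p) ^ k < e"
    using real_arch_pow_inv[OF assms, of "1 / real p"] p_gt_1 by auto
  thus thesis using that[of k] by (simp add: power_int_minus power_one_over inverse_eq_divide)
qed

definition pball :: "padic \<Rightarrow> int \<Rightarrow> padic set" where
  "pball a k = {x \<in> carrier Qp. D x a \<le> real p powi k}"

text \<open>All multiplication takes place in the rationals: a point is replaced by a rational
  \<open>q\<close> within radius \<open>p powi (k - 1)\<close>, scaled by \<open>p powi k\<close> to
  absolute value at most \<open>1\<close>, assigned its residue digit, and scaled back.\<close>

lemma pball_split:
  "pball (of_rat_p 0) k = (\<Union>d<p. pball (of_rat_p (of_nat d * of_nat p powi (- k))) (k - 1))"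
proof (intro equalityI subsetI)
  have p0: "p > 0" using p_gt_1 by auto
  let ?P = "(of_nat p :: rat) powi (- k)"
  let ?P' = "(of_nat p :: rat) powi k"
  have PP: "?P' * ?P = 1" using p0 by (simp add: power_int_minus)
  have kk: "real p powi k / real p = real p powi (k - 1)" using p0 by (simp add: power_int_diff)
  fix x assume x: "x \<in> pball (of_rat_p 0) k"
  hence xc: "x \<in> carrier Qp" by (simp add: pball_def)
  obtain q where q: "D x (of_rat_p q) < real p powi (k - 1)"
    using of_rat_p_dense[OF xc, of "real p powi (k - 1)"] p0 by (auto simp: D_def)
  have kk1: "real p powi (k - 1) \<le> real p powi k" using p_gt_1 by (intro power_int_increasing) auto
  have "D (of_rat_p q) (of_rat_p 0) \<le> max (D (of_rat_p q) x) (D x (of_rat_p 0))"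
    using xc by (intro D_ultrametric) auto
  also have "\<dots> \<le> real p powi k"
    using x q kk1 D_commute[of x "of_rat_p q"] xc by (auto simp: pball_def)
  finally have "rat_padic_abs p q \<le> real p powi k" by (simp add: D_of_rat_p)
  hence "rat_padic_abs p (q * ?P') \<le> 1"
    using p0 by (simp add: rat_padic_abs_mult[OF prime_p] rat_padic_abs_of_nat_p[OF prime_p] power_int_minus field_simps)
  then obtain d where d: "d < p" "rat_padic_abs p (q * ?P' - of_nat d) \<le> 1 / real p"
    using rat_padic_residue[OF prime_p] by blast
  have "q - of_nat d * ?P = (q * ?P' - of_nat d) * ?P" using PP by (simp add: algebra_simps)
  hence "rat_padic_abs p (q - of_nat d * ?P) = rat_padic_abs p (q * ?P' - of_nat d) * real p powi k"
    by (simp add: rat_padic_abs_mult[OF prime_p] rat_padic_abs_of_nat_p[OF prime_p])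
  also have "\<dots> \<le> 1 / real p * real p powi k" using d(2) by (intro mult_right_mono) auto
  also have "\<dots> = real p powi (k - 1)" using kk by simp
  finally have "D (of_rat_p q) (of_rat_p (of_nat d * ?P)) \<le> real p powi (k - 1)" by (simp add: D_of_rat_p)
  hence "D x (of_rat_p (of_nat d * ?P)) \<le> real p powi (k - 1)"
    using D_ultrametric[OF xc of_rat_p_carrier of_rat_p_carrier, of "of_nat d * ?P" q] q by simp
  thus "x \<in> (\<Union>d<p. pball (of_rat_p (of_nat d * ?P)) (k - 1))" using d(1) xc by (auto simp: pball_def)
next
  let ?P = "(of_nat p :: rat) powi (- k)"
  fix x assume "x \<in> (\<Union>d<p. pball (of_rat_p (of_nat d * ?P)) (k - 1))"
  then obtain d where d: "x \<in> carrier Qp" "D x (of_rat_p (of_nat d * ?P)) \<le> real p powi (k - 1)"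
    by (auto simp: pball_def)
  have kk1: "real p powi (k - 1) \<le> real p powi k" using p_gt_1 by (intro power_int_increasing) auto
  have d1: "rat_padic_abs p (of_nat d) \<le> 1"
  proof (cases "d = 0")
    case False
    thus ?thesis using rat_padic_abs_divide[OF prime_p, of "int d" 1] p_gt_1
      by (simp add: power_int_minus inverse_le_1_iff one_le_power_int)
  qed simp
  have "rat_padic_abs p (of_nat d * ?P) \<le> 1 * real p powi k"
    unfolding rat_padic_abs_mult[OF prime_p] rat_padic_abs_of_nat_p[OF prime_p] using d1
    by (intro mult_mono) auto
  hence "D (of_rat_p (of_nat d * ?P)) (of_rat_p 0) \<le> real p powi k" by (simp add: D_of_rat_p)
  thus "x \<in> pball (of_rat_p 0) k"
    using d kk1 D_ultrametric[OF d(1) of_rat_p_carrier of_rat_p_carrier, of 0 "of_nat d * ?P"]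
    by (simp add: pball_def)
qed

text \<open>Distinct digits differ by an integer prime to \<open>p\<close>, so two centres lie at
  distance exactly \<open>p powi k\<close>, more than the radius.\<close>

lemma pball_split_disjoint:
  "disjoint_family_on (\<lambda>d. pball (of_rat_p (of_nat d * of_nat p powi (- k))) (k - 1)) {..<p}"
proof (rule ccontr)
  let ?P = "(of_nat p :: rat) powi (- k)"
  assume "\<not> ?thesis"
  then obtain d e x where de: "d < p" "e < p" "d \<noteq> e" and x: "x \<in> carrier Qp"
    and xd: "D x (of_rat_p (of_nat d * ?P)) \<le> real p powi (k - 1)"
    and xe: "D x (of_rat_p (of_nat e * ?P)) \<le> real p powi (k - 1)"
    unfolding disjoint_family_on_def pball_def by blast
  have nd: "\<not> int p dvd int d - int e"
  proof
    assume "int p dvd int d - int e"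
    hence "int p \<le> \<bar>int d - int e\<bar>" using de(3) dvd_imp_le_int[of "int d - int e" "int p"] by simp
    thus False using de by linarith
  qed
  have "of_nat d * ?P - of_nat e * ?P = of_int (int d - int e) * ?P" by (simp add: algebra_simps)
  hence "D (of_rat_p (of_nat d * ?P)) (of_rat_p (of_nat e * ?P)) = real p powi k"
    by (simp only: D_of_rat_p rat_padic_abs_mult[OF prime_p] rat_padic_abs_of_nat_p[OF prime_p]
        rat_padic_abs_of_int_unit[OF prime_p nd]) simp
  moreover have "\<dots> > real p powi (k - 1)" using p_gt_1 by (intro power_int_strict_increasing) auto
  ultimately show False
    using D_ultrametric[OF of_rat_p_carrier x of_rat_p_carrier, of "of_nat d * ?P" "of_nat e * ?P"]
      D_commute[OF x, of "of_rat_p (of_nat d * ?P)"] xd xe by simp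
qed

lemma Metric_space_Qp: "Metric_space (carrier Qp) (padic_dist p)"
proof
  fix x y z assume c: "x \<in> carrier Qp" "y \<in> carrier Qp" "z \<in> carrier Qp"
  show "padic_dist p x z \<le> padic_dist p x y + padic_dist p y z"
    using D_ultrametric[OF c] D_nonneg[OF c(1,2)] D_nonneg[OF c(2,3)] c
    by (simp add: padic_dist_def D_def[symmetric])
qed (auto simp: padic_dist_def D_def[symmetric] D_nonneg D_commute D_eq_0_iff)

text \<open>Every point of an ultrametric ball is a centre, so the open metric ball of the same
  radius around it stays inside.\<close>

lemma openin_pball:
  assumes a: "a \<in> carrier Qp" shows "openin (padic_topology p) (pball a k)"
proof -
  interpret Metric_space "carrier Qp" "padic_dist p" by (rule Metric_space_Qp)
  have "mball x (real p powi k) \<subseteq> pball a k" if "x \<in> pball a k" for x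
  proof
    fix y assume "y \<in> mball x (real p powi k)"
    hence "x \<in> carrier Qp" "y \<in> carrier Qp" "D y x < real p powi k"
      using D_commute[of x y] by (auto simp: mball_def padic_dist_def D_def[symmetric])
    thus "y \<in> pball a k" using D_ultrametric[of y x a] a that by (auto simp: pball_def)
  qed
  moreover have "real p powi k > 0" using p_gt_1 by simp
  moreover have "pball a k \<subseteq> carrier Qp" by (auto simp: pball_def)
  ultimately show ?thesis unfolding padic_topology_def openin_mtopology by blast
qed

end

section \<open>Haar measure of balls\<close>

locale padic_haar = padic_numbers +
  fixes \<mu> :: "padic measure"
  assumes haar: "normalized_padic_Haar p \<mu>"
begin

lemma sets_haar: "sets \<mu> = sigma_sets (carrier Qp) {U. openin (padic_topology p) U}"
proof -
  interpret Metric_space "carrier Qp" "padic_dist p" by (rule Metric_space_Qp)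
  have "{U. openin (padic_topology p) U} \<subseteq> Pow (carrier Qp)"
    using openin_subset by (fastforce simp: padic_topology_def)
  thus ?thesis using haar by (simp add: normalized_padic_Haar_def padic_borel_def)
qed

lemma space_haar [simp]: "space \<mu> = carrier Qp"
proof -
  have "sets \<mu> = sets (padic_borel p)" using haar by (simp add: normalized_padic_Haar_def)
  from sets_eq_imp_space_eq[OF this] show ?thesis by (simp add: padic_borel_def space_measure_of_conv)
qed

lemma pball_sets [measurable]: "a \<in> carrier Qp \<Longrightarrow> pball a k \<in> sets \<mu>"
  using openin_pball by (auto simp: sets_haar intro: sigma_sets.Basic)

lemma emeasure_pball_translate:
  assumes a: "a \<in> carrier Qp"
  shows "emeasure \<mu> (pball a k) = emeasure \<mu> (pball \<zero>\<^bsub>Qp\<^esub> k)"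
proof -
  have "pball a k = (\<lambda>x. a \<oplus>\<^bsub>Qp\<^esub> x) ` pball \<zero>\<^bsub>Qp\<^esub> k"
  proof (intro equalityI subsetI)
    fix y assume y: "y \<in> pball a k"
    hence yc: "y \<in> carrier Qp" by (simp add: pball_def)
    have eq: "y = a \<oplus>\<^bsub>Qp\<^esub> (y \<ominus>\<^bsub>Qp\<^esub> a)" using a yc by algebra
    have "D (y \<ominus>\<^bsub>Qp\<^esub> a) \<zero>\<^bsub>Qp\<^esub> = D (a \<oplus>\<^bsub>Qp\<^esub> (y \<ominus>\<^bsub>Qp\<^esub> a)) (a \<oplus>\<^bsub>Qp\<^esub> \<zero>\<^bsub>Qp\<^esub>)"
      using a yc by (intro D_translate[symmetric]) auto
    also have "\<dots> = D y a" using eq a by simp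
    finally have "y \<ominus>\<^bsub>Qp\<^esub> a \<in> pball \<zero>\<^bsub>Qp\<^esub> k" using y a by (simp add: pball_def)
    thus "y \<in> (\<lambda>x. a \<oplus>\<^bsub>Qp\<^esub> x) ` pball \<zero>\<^bsub>Qp\<^esub> k" using eq by blast
  next
    fix y assume "y \<in> (\<lambda>x. a \<oplus>\<^bsub>Qp\<^esub> x) ` pball \<zero>\<^bsub>Qp\<^esub> k"
    then obtain x where "x \<in> pball \<zero>\<^bsub>Qp\<^esub> k" "y = a \<oplus>\<^bsub>Qp\<^esub> x" by blast
    thus "y \<in> pball a k" using a D_translate[of x "\<zero>\<^bsub>Qp\<^esub>" a] by (simp add: pball_def)
  qed
  thus ?thesis using haar a pball_sets[of "\<zero>\<^bsub>Qp\<^esub>" k] by (simp add: normalized_padic_Haar_def)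
qed

lemma emeasure_pball_step:
  "emeasure \<mu> (pball \<zero>\<^bsub>Qp\<^esub> k) = of_nat p * emeasure \<mu> (pball \<zero>\<^bsub>Qp\<^esub> (k - 1))"
proof -
  let ?B = "\<lambda>d. pball (of_rat_p (of_nat d * of_nat p powi (- k))) (k - 1)"
  have "emeasure \<mu> (pball \<zero>\<^bsub>Qp\<^esub> k) = emeasure \<mu> (\<Union>d<p. ?B d)"
    using pball_split[of k] by (simp add: of_rat_p_0)
  also have "\<dots> = (\<Sum>d<p. emeasure \<mu> (?B d))"
    using pball_split_disjoint by (intro sum_emeasure[symmetric]) auto
  also have "\<dots> = (\<Sum>d<p. emeasure \<mu> (pball \<zero>\<^bsub>Qp\<^esub> (k - 1)))"
    by (intro sum.cong refl emeasure_pball_translate) auto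
  finally show ?thesis by simp
qed

text \<open>The ball with \<open>k = 0\<close> is \<open>padic_int p\<close>, of mass
  \<open>1\<close> by normalization; \<open>emeasure_pball_step\<close> propagates this in both
  directions.\<close>

lemma emeasure_pball_zero: "emeasure \<mu> (pball \<zero>\<^bsub>Qp\<^esub> k) = ennreal (real p powi k)"
proof -
  let ?v = "\<lambda>k. emeasure \<mu> (pball \<zero>\<^bsub>Qp\<^esub> k)"
  have p0: "real p > 0" using p_gt_1 by simp
  have pn: "of_nat p = ennreal (real p)" by (simp add: ennreal_of_nat_eq_real_of_nat)
  have "pball \<zero>\<^bsub>Qp\<^esub> 0 = padic_int p" by (auto simp: pball_def padic_int_def D_zero)
  hence v0: "?v 0 = 1" using haar by (simp add: normalized_padic_Haar_def)
  have "?v (int n) = ennreal (real p powi (int n)) \<and> ?v (- int n) = ennreal (real p powi (- int n))" for n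
  proof (induction n)
    case 0 thus ?case by (simp add: v0)
  next
    case (Suc n)
    have "?v (int (Suc n)) = ennreal (real p * real p powi (int n))"
      using emeasure_pball_step[of "int (Suc n)"] Suc pn p0 by (simp add: ennreal_mult)
    hence 1: "?v (int (Suc n)) = ennreal (real p powi (int (Suc n)))"
      using p0 by (simp add: power_int_add)
    have s: "ennreal (real p powi (- int n)) = ennreal (real p) * ?v (- int (Suc n))"
    proof -
      have "- int (Suc n) = - int n - 1" by simp
      thus ?thesis using emeasure_pball_step[of "- int n"] Suc pn by (simp only:)
    qed
    \<comment> \<open>Only after finiteness is known can the factor \<open>p\<close> be cancelled in
      the reals.\<close>
    have nt: "?v (- int (Suc n)) \<noteq> \<infinity>"
      using s p0 by (auto simp: ennreal_mult_top)
    then obtain r where r: "r \<ge> 0" "?v (- int (Suc n)) = ennreal r" by (cases "?v (- int (Suc n))") auto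
    have "real p powi (- int n) = real p * r"
      using s r p0 by (simp flip: ennreal_mult)
    hence "r = real p powi (- int (Suc n))"
      using p0 unfolding power_int_minus power_int_of_nat by (simp add: field_simps)
    thus ?case using 1 r by simp
  qed
  from this[of "nat k"] this[of "nat (- k)"] show ?thesis by (cases "k \<ge> 0") auto
qed

lemma emeasure_pball: "a \<in> carrier Qp \<Longrightarrow> emeasure \<mu> (pball a k) = ennreal (real p powi k)"
  by (simp add: emeasure_pball_translate emeasure_pball_zero)

lemma p_powi_less_iff: "real p powi a < real p powi b \<longleftrightarrow> a < b"
  using power_int_strict_increasing[of a b "real p"] power_int_increasing[of b a "real p"] p_gt_1
  by (cases "a < b") auto

lemma p_powi_le_iff: "real p powi a \<le> real p powi b \<longleftrightarrow> a \<le> b"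
  using p_powi_less_iff[of b a] by linarith

text \<open>The exponent \<open>2 * n - k\<close> is that of the \<open>D\<close>-radius of a
  spherical ball of level \<open>k\<close> around a point with \<open>psi\<close> equal to
  \<open>p ^ n\<close>; see \<open>sd_ball_near\<close>.\<close>

lemma p_powi_twice_diff: "real p powi (2 * int n - int k) = (real p ^ n)\<^sup>2 / real p ^ k"
proof -
  have "real p powi (2 * int n - int k) = real p powi (int (2 * n)) / real p powi (int k)"
    using power_int_diff[of "real p" "2 * int n" "int k"] p_gt_1
    by (simp only: of_nat_mult of_nat_numeral) simp
  also have "\<dots> = (real p ^ n)\<^sup>2 / real p ^ k"
    by (simp only: power_int_of_nat power_even_eq)
  finally show ?thesis .
qed

lemma power_int_bounds:
  obtains n :: nat where "r \<le> real p powi (int n)"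
proof -
  obtain n where "r < real p ^ n" using real_arch_pow[OF p_gt_1] by blast
  thus thesis using that[of n] by simp
qed

sublocale sigma_finite_measure \<mu>
proof
  have "(\<Union>n. pball \<zero>\<^bsub>Qp\<^esub> (int n)) = carrier Qp"
  proof (intro equalityI subsetI)
    fix x assume "x \<in> carrier Qp"
    thus "x \<in> (\<Union>n. pball \<zero>\<^bsub>Qp\<^esub> (int n))"
      using power_int_bounds[of "D x \<zero>\<^bsub>Qp\<^esub>"] by (auto simp: pball_def)
  qed (auto simp: pball_def)
  thus "\<exists>A. countable A \<and> A \<subseteq> sets \<mu> \<and> \<Union>A = space \<mu> \<and> (\<forall>a\<in>A. emeasure \<mu> a \<noteq> \<infinity>)"
    by (intro exI[of _ "range (\<lambda>n. pball \<zero>\<^bsub>Qp\<^esub> (int n))"]) (auto simp: emeasure_pball_zero)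
qed

text \<open>Membership in the product sigma-algebra comes from countability: density of the
  rationals exhibits the set as a countable union of squares of balls with rational centres.\<close>

lemma D_le_sets: "{z \<in> space (\<mu> \<Otimes>\<^sub>M \<mu>). D (fst z) (snd z) \<le> real p powi k} \<in> sets (\<mu> \<Otimes>\<^sub>M \<mu>)"
proof -
  have "{z \<in> space (\<mu> \<Otimes>\<^sub>M \<mu>). D (fst z) (snd z) \<le> real p powi k} =
      (\<Union>q. pball (of_rat_p q) k \<times> pball (of_rat_p q) k)" (is "?L = ?R")
  proof (intro equalityI subsetI)
    fix z assume "z \<in> ?L"
    then obtain x y where z: "z = (x, y)" "x \<in> carrier Qp" "y \<in> carrier Qp" "D x y \<le> real p powi k"
      by (auto simp: space_pair_measure)
    obtain q where q: "D x (of_rat_p q) < real p powi k"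
      using of_rat_p_dense[of x "real p powi k"] z p_gt_1 by (auto simp: D_def)
    have "D y (of_rat_p q) \<le> real p powi k"
      using D_ultrametric[of y x "of_rat_p q"] z q D_commute[of x y] by auto
    thus "z \<in> ?R" using z q by (auto simp: pball_def intro!: exI[of _ q])
  next
    fix z assume "z \<in> ?R"
    then obtain q x y where z: "z = (x, y)" "x \<in> pball (of_rat_p q) k" "y \<in> pball (of_rat_p q) k" by auto
    thus "z \<in> ?L" using D_ultrametric[of x "of_rat_p q" y] D_commute[of y "of_rat_p q"]
      by (auto simp: pball_def space_pair_measure)
  qed
  also have "\<dots> \<in> sets (\<mu> \<Otimes>\<^sub>M \<mu>)" by (intro sets.countable_UN) auto
  finally show ?thesis .
qed

lemma D_measurable [measurable]: "(\<lambda>z. D (fst z) (snd z)) \<in> borel_measurable (\<mu> \<Otimes>\<^sub>M \<mu>)"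
proof (rule borel_measurableI_less)
  fix a :: real
  have "{z \<in> space (\<mu> \<Otimes>\<^sub>M \<mu>). D (fst z) (snd z) < a} =
      (\<Union>k\<in>{k. real p powi k < a}. {z \<in> space (\<mu> \<Otimes>\<^sub>M \<mu>). D (fst z) (snd z) \<le> real p powi k})" (is "?L = ?R")
  proof (intro equalityI subsetI)
    fix z assume z: "z \<in> ?L"
    then obtain x y where xy: "z = (x, y)" "x \<in> carrier Qp" "y \<in> carrier Qp" "D x y < a"
      by (auto simp: space_pair_measure)
    \<comment> \<open>A nonzero distance is itself a power of \<open>p\<close> and serves as its own
      bound; distance \<open>0\<close> is caught by any power below \<open>a\<close>.\<close>
    have "\<exists>k. real p powi k < a \<and> D x y \<le> real p powi k"
    proof (cases "D x y = 0")
      case True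
      hence "a > 0" using xy by simp
      then obtain k where "real p powi (- int k) < a" by (rule p_powi_arbitrarily_small)
      thus ?thesis using True p_gt_1 by (intro exI[of _ "- int k"]) auto
    next
      case False
      thus ?thesis using D_values[OF xy(2,3)] xy(4) by auto
    qed
    thus "z \<in> ?R" using z xy by auto
  qed auto
  also have "\<dots> \<in> sets (\<mu> \<Otimes>\<^sub>M \<mu>)" using D_le_sets by (intro sets.countable_UN') auto
  finally show "{z \<in> space (\<mu> \<Otimes>\<^sub>M \<mu>). D (fst z) (snd z) < a} \<in> sets (\<mu> \<Otimes>\<^sub>M \<mu>)" .
qed

lemma D_measurable1 [measurable]:
  assumes [measurable]: "a \<in> carrier Qp"
  shows "(\<lambda>x. D x a) \<in> borel_measurable \<mu>"
proof -
  have "(\<lambda>x. (x, a)) \<in> \<mu> \<rightarrow>\<^sub>M \<mu> \<Otimes>\<^sub>M \<mu>" using assms by simp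
  from measurable_compose[OF this D_measurable] show ?thesis by simp
qed

lemma psi_eq: "x \<in> carrier Qp \<Longrightarrow> padic_psi p x = max (D x \<zero>\<^bsub>Qp\<^esub>) 1"
  by (simp add: padic_psi_def D_zero)

lemma psi_measurable [measurable]: "padic_psi p \<in> borel_measurable \<mu>"
proof -
  have "(\<lambda>x. max (D x \<zero>\<^bsub>Qp\<^esub>) 1) \<in> borel_measurable \<mu>" by measurable
  thus ?thesis by (rule iffD2[OF measurable_cong, rotated]) (simp add: psi_eq)
qed

lemma psi_ge_1: "padic_psi p x \<ge> 1"
  by (simp add: padic_psi_def)

lemma psi_values:
  assumes "x \<in> carrier Qp" shows "\<exists>n::nat. padic_psi p x = real p powi (int n)"
proof (cases "D x \<zero>\<^bsub>Qp\<^esub> \<le> 1")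
  case True
  thus ?thesis using assms by (intro exI[of _ 0]) (simp add: psi_eq)
next
  case False
  then obtain k where k: "D x \<zero>\<^bsub>Qp\<^esub> = real p powi k"
    using D_values[OF assms, of "\<zero>\<^bsub>Qp\<^esub>"] by auto
  have "k \<ge> 0"
  proof (rule ccontr)
    assume "\<not> k \<ge> 0"
    hence "real p powi k \<le> real p powi 0" using p_gt_1 by (intro power_int_increasing) auto
    thus False using False k by simp
  qed
  thus ?thesis using k False assms by (intro exI[of _ "nat k"]) (simp add: psi_eq)
qed

end

section \<open>The spherical metric and measure\<close>

context padic_haar
begin

abbreviation psi :: "padic \<Rightarrow> real" where "psi \<equiv> padic_psi p"

text \<open>The chordal metric: \<open>psi x\<close> is the maximum norm of the vector
  \<open>(x, 1)\<close>, and \<open>D x y\<close> is the absolute value of the determinant of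
  \<open>(x, 1)\<close> and \<open>(y, 1)\<close>.\<close>

definition sd :: "padic \<Rightarrow> padic \<Rightarrow> real" where
  "sd x y = D x y / (psi x * psi y)"

definition sm :: "padic measure" where
  "sm = density \<mu> (\<lambda>x. ennreal (1 / (psi x)\<^sup>2))"

lemma space_sm [simp]: "space sm = carrier Qp" and sets_sm [measurable_cong]: "sets sm = sets \<mu>"
  by (simp_all add: sm_def)

lemma psi_pos [simp]: "psi x > 0"
  using psi_ge_1[of x] by linarith

lemma psi_nonzero [simp]: "psi x \<noteq> 0"
  using psi_pos[of x] by linarith

lemma emeasure_sm_const:
  assumes A: "A \<in> sets \<mu>" and c: "\<And>x. x \<in> A \<Longrightarrow> psi x = c"
  shows "emeasure sm A = ennreal (1 / c\<^sup>2) * emeasure \<mu> A"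
proof -
  have "emeasure sm A = (\<integral>\<^sup>+x. ennreal (1 / (psi x)\<^sup>2) * indicator A x \<partial>\<mu>)"
    unfolding sm_def using A by (intro emeasure_density) auto
  also have "\<dots> = (\<integral>\<^sup>+x. ennreal (1 / c\<^sup>2) * indicator A x \<partial>\<mu>)"
    by (intro nn_integral_cong) (auto simp: c split: split_indicator)
  finally show ?thesis using A by (simp add: nn_integral_cmult_indicator)
qed

definition psphere :: "nat \<Rightarrow> padic set" where
  "psphere n = {x \<in> carrier Qp. D x \<zero>\<^bsub>Qp\<^esub> = real p powi (int n)}"

lemma psphere_eq: "psphere n = pball \<zero>\<^bsub>Qp\<^esub> (int n) - pball \<zero>\<^bsub>Qp\<^esub> (int n - 1)"
proof (intro equalityI subsetI)
  fix x assume "x \<in> pball \<zero>\<^bsub>Qp\<^esub> (int n) - pball \<zero>\<^bsub>Qp\<^esub> (int n - 1)"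
  hence x: "x \<in> carrier Qp" "D x \<zero>\<^bsub>Qp\<^esub> \<le> real p powi (int n)" "real p powi (int n - 1) < D x \<zero>\<^bsub>Qp\<^esub>"
    by (auto simp: pball_def)
  have "real p powi (int n - 1) > 0" using p_gt_1 by simp
  hence "D x \<zero>\<^bsub>Qp\<^esub> \<noteq> 0" using x(3) by linarith
  then obtain k where k: "D x \<zero>\<^bsub>Qp\<^esub> = real p powi k" using D_values[OF x(1), of "\<zero>\<^bsub>Qp\<^esub>"] by auto
  have "k \<le> int n" using x(2) p_gt_1 unfolding k by (simp only: p_powi_le_iff)
  moreover have "int n - 1 < k" using x(3) p_gt_1 unfolding k by (simp only: p_powi_less_iff)
  ultimately have "k = int n" by simp
  thus "x \<in> psphere n" using x k by (simp add: psphere_def)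
next
  fix x assume "x \<in> psphere n"
  moreover have "real p powi (int n - 1) < real p powi (int n)"
    using p_gt_1 by (intro power_int_strict_increasing) auto
  ultimately show "x \<in> pball \<zero>\<^bsub>Qp\<^esub> (int n) - pball \<zero>\<^bsub>Qp\<^esub> (int n - 1)"
    by (auto simp: psphere_def pball_def)
qed

text \<open>The Haar mass \<open>p ^ n - p ^ (n - 1)\<close> is divided by the constant value
  \<open>p ^ (2 * n)\<close> of \<open>psi\<close> squared.\<close>

lemma emeasure_sm_psphere: "n \<ge> 1 \<Longrightarrow> emeasure sm (psphere n) = ennreal ((1 - 1 / real p) * (1 / real p) ^ n)"
proof -
  assume n: "n \<ge> 1"
  have p0: "real p > 0" using p_gt_1 by simp
  have sub: "pball \<zero>\<^bsub>Qp\<^esub> (int n - 1) \<subseteq> pball \<zero>\<^bsub>Qp\<^esub> (int n)"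
    using power_int_increasing[of "int n - 1" "int n" "real p"] p_gt_1 by (auto simp: pball_def)
  have "emeasure \<mu> (psphere n) = emeasure \<mu> (pball \<zero>\<^bsub>Qp\<^esub> (int n)) - emeasure \<mu> (pball \<zero>\<^bsub>Qp\<^esub> (int n - 1))"
    unfolding psphere_eq using sub by (intro emeasure_Diff) (auto simp: emeasure_pball_zero)
  also have "\<dots> = ennreal (real p ^ n - real p powi (int n - 1))"
    using p0 by (simp add: emeasure_pball_zero ennreal_minus)
  finally have mu: "emeasure \<mu> (psphere n) = ennreal (real p ^ n - real p powi (int n - 1))" .
  have "emeasure sm (psphere n) = ennreal (1 / (real p ^ n)\<^sup>2) * emeasure \<mu> (psphere n)"
  proof (rule emeasure_sm_const)
    show "psphere n \<in> sets \<mu>" unfolding psphere_eq by measurable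
    fix x assume "x \<in> psphere n"
    thus "psi x = real p ^ n" using p_gt_1 by (auto simp: psphere_def psi_eq one_le_power)
  qed
  also have "\<dots> = ennreal (1 / (real p ^ n)\<^sup>2 * (real p ^ n - real p powi (int n - 1)))"
    unfolding mu by (rule ennreal_mult'[symmetric]) simp
  also have "1 / (real p ^ n)\<^sup>2 * (real p ^ n - real p powi (int n - 1)) = (1 - 1 / real p) * (1 / real p) ^ n"
    using p0 by (simp add: power_int_diff power2_eq_square power_one_over field_simps)
  finally show ?thesis .
qed

text \<open>The spherical ball around the point at infinity.\<close>

definition inf_ball :: "nat \<Rightarrow> padic set" where
  "inf_ball k = {x \<in> carrier Qp. D x \<zero>\<^bsub>Qp\<^esub> \<ge> real p ^ k}"

lemma inf_ball_sets [measurable]: "inf_ball k \<in> sets \<mu>"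
proof -
  have "{x \<in> space \<mu>. real p ^ k \<le> D x \<zero>\<^bsub>Qp\<^esub>} \<in> sets \<mu>" by measurable
  thus ?thesis by (simp add: inf_ball_def)
qed

lemma emeasure_sm_inf_ball:
  assumes k: "k \<ge> 1" shows "emeasure sm (inf_ball k) = ennreal ((1 / real p) ^ k)"
proof -
  have p0: "real p > 0" using p_gt_1 by simp
  have "inf_ball k = (\<Union>n. psphere (k + n))"
  proof (intro equalityI subsetI)
    fix x assume "x \<in> inf_ball k"
    hence x: "x \<in> carrier Qp" "real p ^ k \<le> D x \<zero>\<^bsub>Qp\<^esub>" by (auto simp: inf_ball_def)
    have "real p ^ k > 0" using p0 by simp
    hence "D x \<zero>\<^bsub>Qp\<^esub> \<noteq> 0" using x by linarith
    then obtain j where j: "D x \<zero>\<^bsub>Qp\<^esub> = real p powi j" using D_values[OF x(1), of "\<zero>\<^bsub>Qp\<^esub>"] by auto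
    have "real p powi (int k) \<le> real p powi j" using x(2) j by simp
    hence "int k \<le> j" by (simp only: p_powi_le_iff)
    thus "x \<in> (\<Union>n. psphere (k + n))" using x j
      by (auto simp: psphere_def intro!: exI[of _ "nat (j - int k)"] simp del: power_int_of_nat)
  next
    fix x assume "x \<in> (\<Union>n. psphere (k + n))"
    thus "x \<in> inf_ball k" using p_gt_1
      by (auto simp: psphere_def inf_ball_def power_increasing simp flip: of_nat_add)
  qed
  moreover have "disjoint_family (\<lambda>n. psphere (k + n))"
    using p_gt_1 by (auto simp: disjoint_family_on_def psphere_def simp flip: of_nat_add)
  moreover have "psphere n \<in> sets sm" for n unfolding psphere_eq sets_sm by measurable
  ultimately have "emeasure sm (inf_ball k) = (\<Sum>n. emeasure sm (psphere (k + n)))"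
    by (auto intro!: suminf_emeasure[symmetric])
  also have "\<dots> = (\<Sum>n. ennreal ((1 - 1 / real p) * (1 / real p) ^ k * (1 / real p) ^ n))"
    using k by (intro suminf_cong) (simp add: emeasure_sm_psphere power_add mult.assoc)
  also have "\<dots> = ennreal ((1 / real p) ^ k)"
  proof (rule suminf_ennreal_eq)
    have "(\<lambda>n. (1 - 1 / real p) * (1 / real p) ^ k * (1 / real p) ^ n) sums
        ((1 - 1 / real p) * (1 / real p) ^ k * (1 / (1 - 1 / real p)))"
      using p_gt_1 by (intro sums_mult geometric_sums) simp
    thus "(\<lambda>n. (1 - 1 / real p) * (1 / real p) ^ k * (1 / real p) ^ n) sums ((1 / real p) ^ k)"
      using p_gt_1 by simp
  qed (use p_gt_1 in auto)
  finally show ?thesis .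
qed

text \<open>The unit ball contributes \<open>1\<close> and the residue class of infinity
  \<open>1 / p\<close>: together, \<open>p + 1\<close> residue classes of mass \<open>1 / p\<close>
  each.\<close>

lemma emeasure_sm_space: "emeasure sm (carrier Qp) = ennreal (1 + 1 / real p)"
proof -
  have p0: "real p > 0" using p_gt_1 by simp
  have eq: "carrier Qp = pball \<zero>\<^bsub>Qp\<^esub> 0 \<union> inf_ball 1"
  proof (intro equalityI subsetI)
    fix x assume x: "x \<in> carrier Qp"
    show "x \<in> pball \<zero>\<^bsub>Qp\<^esub> 0 \<union> inf_ball 1"
    proof (cases "D x \<zero>\<^bsub>Qp\<^esub> \<le> 1")
      case False
      then obtain j where j: "D x \<zero>\<^bsub>Qp\<^esub> = real p powi j" using D_values[OF x, of "\<zero>\<^bsub>Qp\<^esub>"] by auto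
      have "real p powi 0 < real p powi j" using False j by simp
      hence "1 \<le> j" by (simp only: p_powi_less_iff)
      hence "real p powi 1 \<le> real p powi j" using p_gt_1 by (intro power_int_increasing) auto
      thus ?thesis using x j by (simp add: inf_ball_def)
    qed (use x in \<open>simp add: pball_def\<close>)
  qed (auto simp: pball_def inf_ball_def)
  have "emeasure sm (pball \<zero>\<^bsub>Qp\<^esub> 0) = ennreal (1 / 1\<^sup>2) * emeasure \<mu> (pball \<zero>\<^bsub>Qp\<^esub> 0)"
    by (rule emeasure_sm_const[OF pball_sets]) (auto simp: pball_def psi_eq)
  hence 1: "emeasure sm (pball \<zero>\<^bsub>Qp\<^esub> 0) = 1" by (simp add: emeasure_pball_zero)
  have "emeasure sm (carrier Qp) = emeasure sm (pball \<zero>\<^bsub>Qp\<^esub> 0) + emeasure sm (inf_ball 1)"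
    unfolding eq using p_gt_1
    by (intro plus_emeasure[symmetric]) (auto simp: sets_sm disjoint_iff, auto simp: pball_def inf_ball_def)
  thus ?thesis using p0 by (simp add: 1 emeasure_sm_inf_ball ennreal_plus)
qed

sublocale sm: finite_measure sm
  by (rule finite_measureI) (simp add: emeasure_sm_space)

text \<open>Such a \<open>y\<close> lies within \<open>(1 / p) ^ k\<close> of infinity, and every
  point of an ultrametric ball is a centre. With \<open>N\<close>, \<open>M\<close>,
  \<open>d\<close> for the two norms and the distance, this reduces to real inequalities.\<close>

lemma sd_ball_far:
  assumes y: "y \<in> carrier Qp" and k: "k \<ge> 1" and far: "D y \<zero>\<^bsub>Qp\<^esub> \<ge> real p ^ k"
  shows "{x \<in> carrier Qp. sd x y \<le> (1 / real p) ^ k} = inf_ball k"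
proof -
  define R where "R = real p ^ k"
  have R1: "R > 1" using k p_gt_1 by (simp add: R_def one_less_power)
  have "sd x y \<le> (1 / real p) ^ k \<longleftrightarrow> R \<le> D x \<zero>\<^bsub>Qp\<^esub>" if x: "x \<in> carrier Qp" for x
  proof -
    define N M d where "N = D x \<zero>\<^bsub>Qp\<^esub>" "M = D y \<zero>\<^bsub>Qp\<^esub>" "d = D x y"
    have u: "d \<le> max N M" "M \<le> max d N"
      using D_ultrametric[of x "\<zero>\<^bsub>Qp\<^esub>" y] D_ultrametric[of y x "\<zero>\<^bsub>Qp\<^esub>"] D_commute[of x y]
        D_commute[of y "\<zero>\<^bsub>Qp\<^esub>"] x y by (auto simp: N_M_d_def)
    have M: "M \<ge> R" using far by (simp add: N_M_d_def R_def)
    have "psi y = M" "psi x = max N 1" using x y M R1 by (auto simp: psi_eq N_M_d_def)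
    hence "sd x y \<le> (1 / real p) ^ k \<longleftrightarrow> d * R \<le> max N 1 * M"
      using R1 M by (simp add: sd_def N_M_d_def(3)[symmetric] power_one_over R_def[symmetric] field_simps)
    also have "\<dots> \<longleftrightarrow> R \<le> N"
    proof
      assume *: "d * R \<le> max N 1 * M"
      show "R \<le> N"
      proof (rule ccontr)
        assume "\<not> R \<le> N"
        \<comment> \<open>This leads to \<open>d < M\<close>, which together with
          \<open>N < R \<le> M\<close> contradicts \<open>M \<le> max d N\<close>.\<close>
        hence "max N 1 * M < R * M" using R1 M by (intro mult_strict_right_mono) auto
        hence "d * R < M * R" using * by (simp add: mult.commute)
        hence "d < M" using R1 by simp
        thus False using u(2) M \<open>\<not> R \<le> N\<close> by auto
      qed
    next
      assume "R \<le> N"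
      have "d * R \<le> max N M * R" using u(1) R1 by (intro mult_right_mono) auto
      also have "\<dots> \<le> N * M"
        using \<open>R \<le> N\<close> M R1 by (auto simp: max_def mult.commute intro!: mult_left_mono)
      finally show "d * R \<le> max N 1 * M" using \<open>R \<le> N\<close> R1 by (simp add: max_def)
    qed
    finally show ?thesis by (simp add: N_M_d_def)
  qed
  thus ?thesis by (auto simp: inf_ball_def R_def)
qed

text \<open>This ball keeps away from infinity. Since \<open>q = psi y\<close> is less than
  \<open>p ^ k\<close>, the radius \<open>q\<^sup>2 / p ^ k\<close> is less than \<open>q\<close>,
  too small to change \<open>psi\<close>; on the ball \<open>sd\<close> is therefore
  \<open>D\<close> divided by \<open>q\<^sup>2\<close>.\<close>

lemma sd_ball_near:
  assumes y: "y \<in> carrier Qp" and k: "k \<ge> 1" and near: "D y \<zero>\<^bsub>Qp\<^esub> < real p ^ k"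
    and n: "psi y = real p powi (int n)"
  shows "{x \<in> carrier Qp. sd x y \<le> (1 / real p) ^ k} = pball y (2 * int n - int k)"
    and "x \<in> pball y (2 * int n - int k) \<Longrightarrow> psi x = real p powi (int n)"
proof -
  define R where "R = real p ^ k"
  define q where "q = psi y"
  have R1: "R > 1" using k p_gt_1 by (simp add: R_def one_less_power)
  have q1: "q \<ge> 1" "q < R" using psi_ge_1 R1 near y by (auto simp: q_def psi_eq R_def)
  have pw: "real p powi (2 * int n - int k) = q\<^sup>2 / R"
    unfolding p_powi_twice_diff by (simp add: q_def n R_def)
  have *: "(sd x y \<le> (1 / real p) ^ k \<longleftrightarrow> D x y \<le> q\<^sup>2 / R) \<and> (D x y \<le> q\<^sup>2 / R \<longrightarrow> psi x = q)"
    if x: "x \<in> carrier Qp" for x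
  proof -
    define N M d where "N = D x \<zero>\<^bsub>Qp\<^esub>" "M = D y \<zero>\<^bsub>Qp\<^esub>" "d = D x y"
    have u: "N \<le> max d M" "M \<le> max d N"
      using D_ultrametric[of x y "\<zero>\<^bsub>Qp\<^esub>"] D_ultrametric[of y x "\<zero>\<^bsub>Qp\<^esub>"] D_commute[of x y] x y
      by (auto simp: N_M_d_def)
    have qM: "q = max M 1" and px: "psi x = max N 1" using x y by (auto simp: psi_eq N_M_d_def q_def)
    have sd: "sd x y \<le> (1 / real p) ^ k \<longleftrightarrow> d * R \<le> max N 1 * q"
      using R1 q1 px unfolding sd_def N_M_d_def(3)[symmetric] q_def[symmetric]
      by (simp add: power_one_over R_def[symmetric] field_simps)
    have d: "d \<le> q\<^sup>2 / R \<longleftrightarrow> d * R \<le> q * q" using R1 by (simp add: field_simps power2_eq_square)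
    have eqN: "max N 1 = q" if "d < q"
      using that u qM by (auto simp: max_def split: if_splits)
    have 1: "d < q" if "d * R \<le> q * q"
    proof -
      have "q * q < q * R" using q1 by (intro mult_strict_left_mono) auto
      hence "d * R < q * R" using that by linarith
      thus ?thesis using R1 by simp
    qed
    \<comment> \<open>Here \<open>psi x = q\<close> is not yet known. From \<open>q < R\<close>
      follows \<open>d < max N 1\<close>, hence \<open>max N 1 \<le> q\<close> by the ultrametric
      inequality, which suffices.\<close>
    have 2: "d * R \<le> q * q" if "d * R \<le> max N 1 * q"
    proof -
      have "max N 1 * q < max N 1 * R" using q1 by (intro mult_strict_left_mono) auto
      hence "d * R < max N 1 * R" using that by linarith
      hence "d < max N 1" using R1 by simp
      hence "max N 1 \<le> q" using u qM by (auto simp: max_def split: if_splits)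
      hence "max N 1 * q \<le> q * q" using q1 by (intro mult_right_mono) auto
      thus ?thesis using that by linarith
    qed
    show ?thesis using 1 2 sd d eqN px by (auto simp: N_M_d_def(3))
  qed
  show "{x \<in> carrier Qp. sd x y \<le> (1 / real p) ^ k} = pball y (2 * int n - int k)"
    unfolding pball_def pw using * by blast
  show "psi x = real p powi (int n)" if "x \<in> pball y (2 * int n - int k)"
    using that * unfolding pball_def pw n[symmetric] q_def[symmetric] by blast
qed

text \<open>Near the origin, the square of \<open>psi y\<close> in the Haar mass cancels against the
  density, so the centre drops out; a far ball is a ball around infinity.\<close>

lemma emeasure_sd_ball:
  assumes y: "y \<in> carrier Qp" and k: "k \<ge> 1"
  shows "emeasure sm {x \<in> carrier Qp. sd x y \<le> (1 / real p) ^ k} = ennreal ((1 / real p) ^ k)"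
proof (cases "D y \<zero>\<^bsub>Qp\<^esub> \<ge> real p ^ k")
  case True
  thus ?thesis using sd_ball_far[OF y k] emeasure_sm_inf_ball[OF k] by simp
next
  case False
  obtain n where n: "psi y = real p powi (int n)" using psi_values[OF y] by blast
  have near: "D y \<zero>\<^bsub>Qp\<^esub> < real p ^ k" using False by simp
  note * = sd_ball_near[OF y k near n]
  have "emeasure sm (pball y (2 * int n - int k)) =
      ennreal (1 / (real p powi (int n))\<^sup>2) * emeasure \<mu> (pball y (2 * int n - int k))"
    using y *(2) by (intro emeasure_sm_const) auto
  also have "\<dots> = ennreal (1 / (real p powi (int n))\<^sup>2 * real p powi (2 * int n - int k))"
    unfolding emeasure_pball[OF y] by (rule ennreal_mult'[symmetric]) simp
  also have "1 / (real p powi (int n))\<^sup>2 * real p powi (2 * int n - int k) = (1 / real p) ^ k"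
    unfolding p_powi_twice_diff using p_gt_1 by (simp add: power_one_over)
  finally show ?thesis unfolding *(1) .
qed

end

section \<open>Triangles in an ultrametric space\<close>

text \<open>The level of a pair of points is \<open>k\<close> when their distance is \<open>(1 / p) ^ k\<close>, and \<open>v k\<close> is the mass
  of a ball of level \<open>k\<close>. The triple \<open>(k, j, i)\<close> lists the levels of the sides opposite to the fixed
  vertex, to \<open>x\<close> and to \<open>y\<close>. Triangles are isosceles with the two smallest levels equal; in the
  equilateral case \<open>y\<close> avoids the disjoint balls of level \<open>Suc i\<close> around \<open>x\<close> and the fixed vertex.\<close>

definition triangle_slice :: "(nat \<Rightarrow> real) \<Rightarrow> nat \<Rightarrow> nat \<Rightarrow> nat \<Rightarrow> real" where
  "triangle_slice v k j i =
    (if i = j \<and> j = k then v i - 2 * v (Suc i)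
     else if i = j \<and> i < k then v k - v (Suc k)
     else if i = k \<and> i < j \<or> j = k \<and> j < i then v j - v (Suc j)
     else 0)"

text \<open>The first factor is the mass of the points \<open>x\<close> at level \<open>i\<close>
  from the fixed vertex; the slice is the mass of admissible \<open>y\<close> for each such
  \<open>x\<close>.\<close>

definition triangle_law :: "(nat \<Rightarrow> real) \<Rightarrow> nat \<Rightarrow> nat \<Rightarrow> nat \<Rightarrow> real" where
  "triangle_law v k j i = (v i - v (Suc i)) * triangle_slice v k j i"

text \<open>In the isosceles case the law is the product of the sphere masses at the two levels that
  occur, whichever side carries the larger one. This symmetry later matches the vertex labels of the
  two integrals.\<close>

lemma triangle_law_rotate: "triangle_law v j i k = triangle_law v k j i"
  unfolding triangle_law_def triangle_slice_def by auto

text \<open>A sphere is the difference of two consecutive balls. The level function is arbitrary, so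
  that the result serves both \<open>l x\<close> and \<open>e\<close>.\<close>

lemma triangle_law_slice:
  assumes "finite_measure M"
    and l: "{y \<in> space M. enat k \<le> l y} \<in> sets M" "{y \<in> space M. enat (Suc k) \<le> l y} \<in> sets M"
    and v: "measure M {y \<in> space M. enat k \<le> l y} = a" "measure M {y \<in> space M. enat (Suc k) \<le> l y} = b"
  shows "{y \<in> space M. l y = enat k} \<in> sets M" "measure M {y \<in> space M. l y = enat k} = a - b"
proof -
  interpret finite_measure M by fact
  have eq: "{y \<in> space M. l y = enat k} = {y \<in> space M. enat k \<le> l y} - {y \<in> space M. enat (Suc k) \<le> l y}"
    by (auto simp: Suc_ile_eq)
  show "{y \<in> space M. l y = enat k} \<in> sets M" unfolding eq using l by auto
  show "measure M {y \<in> space M. l y = enat k} = a - b"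
    unfolding eq using l v by (subst finite_measure_Diff) (auto simp: Suc_ile_eq)
qed

text \<open>The fixed vertex appears only through \<open>e\<close>, the level of the distance to it,
  and so need not be a point of \<open>M\<close>. Levels reverse the order of distances, which turns
  the ultrametric inequality into statements about \<open>min\<close>.\<close>

locale ultrametric_levels = finite_measure M for M :: "'a measure" +
  fixes l :: "'a \<Rightarrow> 'a \<Rightarrow> enat" and e :: "'a \<Rightarrow> enat" and v :: "nat \<Rightarrow> real"
  assumes l_measurable [measurable]:
      "(\<lambda>z. l (fst z) (snd z)) \<in> M \<Otimes>\<^sub>M M \<rightarrow>\<^sub>M count_space UNIV"
    and e_measurable [measurable]: "e \<in> M \<rightarrow>\<^sub>M count_space UNIV"
    and ultra: "\<And>x y. x \<in> space M \<Longrightarrow> y \<in> space M \<Longrightarrow> min (e x) (e y) \<le> l x y"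
      "\<And>x y. x \<in> space M \<Longrightarrow> y \<in> space M \<Longrightarrow> min (l x y) (e x) \<le> e y"
      "\<And>x y. x \<in> space M \<Longrightarrow> y \<in> space M \<Longrightarrow> min (l x y) (e y) \<le> e x"
    and ball_l: "\<And>x k. x \<in> space M \<Longrightarrow> measure M {y \<in> space M. enat k \<le> l x y} = v k"
    and ball_e: "\<And>k. measure M {y \<in> space M. enat k \<le> e y} = v k"
begin

lemma l_measurable1 [measurable]:
  assumes "x \<in> space M" shows "l x \<in> M \<rightarrow>\<^sub>M count_space UNIV"
proof -
  have "(\<lambda>y. (x, y)) \<in> M \<rightarrow>\<^sub>M M \<Otimes>\<^sub>M M" using assms by simp
  from measurable_compose[OF this l_measurable] show ?thesis by simp
qed

lemma level_sets:
  assumes x: "x \<in> space M"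
  shows "{y \<in> space M. P (l x y) (e y)} \<in> sets M"
proof -
  have [measurable]: "l x \<in> M \<rightarrow>\<^sub>M count_space UNIV" using x by (rule l_measurable1)
  have "(\<lambda>y. (l x y, e y)) \<in> M \<rightarrow>\<^sub>M count_space UNIV \<Otimes>\<^sub>M count_space UNIV" by measurable
  hence "(\<lambda>y. (l x y, e y)) \<in> M \<rightarrow>\<^sub>M count_space UNIV"
    by (simp add: pair_measure_countable)
  from measurable_sets[OF this, of "{(a, b). P a b}"] show ?thesis
    by (simp add: vimage_def Int_def conj_commute)
qed

lemma measure_l_eq:
  "x \<in> space M \<Longrightarrow> measure M {y \<in> space M. l x y = enat k} = v k - v (Suc k)"
  by (rule triangle_law_slice(2)[OF finite_measure_axioms])
     (auto simp: ball_l intro: level_sets)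

lemma measure_e_eq: "measure M {y \<in> space M. e y = enat k} = v k - v (Suc k)"
  by (rule triangle_law_slice(2)[OF finite_measure_axioms]) (auto simp: ball_e)

lemma measure_slice:
  assumes x: "x \<in> space M" and ex: "e x = enat i"
  shows "measure M {y \<in> space M. l x y = enat k \<and> e y = enat j} = triangle_slice v k j i"
proof -
  let ?S = "{y \<in> space M. l x y = enat k \<and> e y = enat j}"
  have u: "min (enat i) (e y) \<le> l x y" "min (l x y) (enat i) \<le> e y" "min (l x y) (e y) \<le> enat i"
    if "y \<in> space M" for y using ultra[OF x that] ex by simp_all
  consider "j < i" "k = j" | "j > i" "k = i" | "j = i" "k > i" | "j = i" "k = i"
    | "\<not> (j < i \<and> k = j)" "\<not> (j > i \<and> k = i)" "\<not> (j = i \<and> k > i)" "\<not> (j = i \<and> k = i)"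
    by linarith
  thus ?thesis
  proof cases
    case 1
    have "l x y = enat j" if "y \<in> space M" "e y = enat j" for y
      using 1 u[OF that(1)] that(2) by (cases "l x y") (auto simp: min_def split: if_splits)
    hence "?S = {y \<in> space M. e y = enat j}" using 1 by auto
    thus ?thesis using 1 by (simp add: measure_e_eq triangle_slice_def)
  next
    case 2
    have "l x y = enat i" if "y \<in> space M" "e y = enat j" for y
      using 2 u[OF that(1)] that(2) by (cases "l x y") (auto simp: min_def split: if_splits)
    hence "?S = {y \<in> space M. e y = enat j}" using 2 by auto
    thus ?thesis using 2 by (simp add: measure_e_eq triangle_slice_def)
  next
    case 3
    have "e y = enat i" if "y \<in> space M" "l x y = enat k" for y
      using 3 u[OF that(1)] that(2) by (cases "e y") (auto simp: min_def split: if_splits)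
    hence "?S = {y \<in> space M. l x y = enat k}" using 3 by auto
    thus ?thesis using 3 x by (simp add: measure_l_eq triangle_slice_def)
  next
    case 4
    let ?A = "{y \<in> space M. enat i \<le> e y}" and ?B = "{y \<in> space M. enat (Suc i) \<le> e y}"
      and ?C = "{y \<in> space M. enat (Suc i) \<le> l x y}"
    have S: "?S = ?A - (?B \<union> ?C)"
    proof (intro equalityI subsetI)
      fix y assume "y \<in> ?A - (?B \<union> ?C)"
      hence y: "y \<in> space M" "enat i \<le> e y" "e y \<le> enat i" "l x y \<le> enat i"
        by (auto simp: Suc_ile_eq)
      hence "e y = enat i" by simp
      thus "y \<in> ?S" using u(1)[OF y(1)] y 4 by simp
    qed (use 4 in auto)
    have BA: "?B \<union> ?C \<subseteq> ?A"
    proof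
      fix y assume y: "y \<in> ?B \<union> ?C"
      hence yM: "y \<in> space M" by auto
      have *: "enat (Suc i) \<le> t \<Longrightarrow> enat i \<le> t" for t by (simp add: Suc_ile_eq)
      show "y \<in> ?A" using y u(2)[OF yM] *[of "e y"] *[of "l x y"] yM by (auto simp: min_def split: if_splits)
    qed
    \<comment> \<open>A common point would force \<open>x\<close> closer to the fixed vertex than
      level \<open>i\<close> allows.\<close>
    have d: "?B \<inter> ?C = {}"
    proof (intro equals0I)
      fix y assume y: "y \<in> ?B \<inter> ?C"
      hence "enat (Suc i) \<le> min (l x y) (e y)" by simp
      also have "\<dots> \<le> enat i" using u(3) y by simp
      finally show False by simp
    qed
    have sets: "?A \<in> sets M" "?B \<in> sets M" "?C \<in> sets M"
      using level_sets[OF x, of "\<lambda>_ t. enat i \<le> t"] level_sets[OF x, of "\<lambda>_ t. enat (Suc i) \<le> t"]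
        level_sets[OF x, of "\<lambda>t _. enat (Suc i) \<le> t"] by simp_all
    have "measure M ?S = measure M ?A - measure M (?B \<union> ?C)"
      unfolding S using sets BA by (intro finite_measure_Diff) auto
    also have "measure M (?B \<union> ?C) = v (Suc i) + v (Suc i)"
      using sets d by (subst finite_measure_Union) (auto simp: ball_e ball_l[OF x])
    finally show ?thesis using 4 by (simp add: ball_e triangle_slice_def)
  next
    case 5
    have "?S = {}"
    proof (intro equals0I)
      fix y assume "y \<in> ?S"
      hence "min i j \<le> k" "min k i \<le> j" "min k j \<le> i"
        using u[of y] by (auto simp: min_def split: if_splits)
      thus False using 5 by linarith
    qed
    hence "measure M ?S = 0" by (simp only: measure_empty)
    moreover have "\<not> (i = j \<and> j = k)" "\<not> (i = j \<and> i < k)"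
      "\<not> (i = k \<and> i < j \<or> j = k \<and> j < i)"
      using 5 by metis+
    hence "triangle_slice v k j i = 0" by (simp only: triangle_slice_def if_False)
    ultimately show ?thesis by (simp only:)
  qed
qed

definition levels :: "'a \<times> 'a \<Rightarrow> enat \<times> enat \<times> enat" where
  "levels z = (l (fst z) (snd z), e (snd z), e (fst z))"

lemma levels_measurable [measurable]: "levels \<in> M \<Otimes>\<^sub>M M \<rightarrow>\<^sub>M count_space UNIV"
proof -
  have "levels \<in> M \<Otimes>\<^sub>M M \<rightarrow>\<^sub>M count_space UNIV \<Otimes>\<^sub>M (count_space UNIV \<Otimes>\<^sub>M count_space UNIV)"
    unfolding levels_def by measurable
  thus ?thesis by (simp add: pair_measure_countable)
qed

lemma measure_levels:
  "measure (M \<Otimes>\<^sub>M M) (levels -` {(enat k, enat j, enat i)} \<inter> space (M \<Otimes>\<^sub>M M)) = triangle_law v k j i"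
proof -
  let ?A = "levels -` {(enat k, enat j, enat i)} \<inter> space (M \<Otimes>\<^sub>M M)"
  let ?E = "{x \<in> space M. e x = enat i}"
  define c where "c = triangle_slice v k j i"
  have A: "?A \<in> sets (M \<Otimes>\<^sub>M M)" by measurable
  have E: "?E \<in> sets M" by measurable
  have slice: "emeasure M (Pair x -` ?A) = ennreal c * indicator ?E x" if x: "x \<in> space M" for x
  proof (cases "e x = enat i")
    case True
    have "Pair x -` ?A = {y \<in> space M. l x y = enat k \<and> e y = enat j}"
      using x True by (auto simp: levels_def space_pair_measure)
    thus ?thesis using measure_slice[OF x True, of k j] x True
      by (simp add: emeasure_eq_measure c_def)
  next
    case False
    hence "Pair x -` ?A = {}" by (auto simp: levels_def)
    thus ?thesis using False by simp
  qed
  have "emeasure (M \<Otimes>\<^sub>M M) ?A = (\<integral>\<^sup>+x. emeasure M (Pair x -` ?A) \<partial>M)"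
    by (rule emeasure_pair_measure_alt[OF A])
  also have "\<dots> = (\<integral>\<^sup>+x. ennreal c * indicator ?E x \<partial>M)"
    by (intro nn_integral_cong slice)
  also have "\<dots> = ennreal c * ennreal (measure M ?E)"
    using E by (simp add: nn_integral_cmult_indicator emeasure_eq_measure)
  finally have *: "emeasure (M \<Otimes>\<^sub>M M) ?A = ennreal c * ennreal (measure M ?E)" .
  show ?thesis
  \<comment> \<open>The passage through \<open>ennreal c\<close> is faithful only for
    \<open>c \<ge> 0\<close>. A witness \<open>x\<close> exhibits \<open>c\<close> as a measure; if
    \<open>?E\<close> has mass \<open>0\<close>, the first factor of \<open>triangle_law\<close>
    vanishes anyway.\<close>
  proof (cases "measure M ?E = 0")
    case True
    hence "measure (M \<Otimes>\<^sub>M M) ?A = 0" using * by (simp add: measure_def)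
    thus ?thesis using True by (simp add: triangle_law_def measure_e_eq)
  next
    case False
    then obtain x where x: "x \<in> space M" "e x = enat i" by (metis (mono_tags, lifting) Collect_empty_eq measure_empty)
    have "c \<ge> 0" using measure_slice[OF x, of k j] by (metis c_def measure_nonneg)
    hence "measure (M \<Otimes>\<^sub>M M) ?A = c * measure M ?E"
      using * by (simp add: measure_def enn2real_mult)
    thus ?thesis by (simp add: triangle_law_def measure_e_eq c_def mult.commute)
  qed
qed

end

text \<open>Levels \<open>\<infinity>\<close> (coinciding points) carry weight \<open>0\<close> below. No null-set argument is needed for this,
  since the integrands of interest vanish there.\<close>

definition triangle_weight :: "(nat \<Rightarrow> real) \<Rightarrow> enat \<times> enat \<times> enat \<Rightarrow> real" where
  "triangle_weight v t = (case t of (enat k, enat j, enat i) \<Rightarrow> triangle_law v k j i | _ \<Rightarrow> 0)"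

text \<open>The distribution of a countably valued map is a density over counting measure. This
  trades integrability for absolute summability, in both directions.\<close>

lemma (in finite_measure) integral_countable_image:
  fixes F :: "'b::countable \<Rightarrow> 'c::{banach, second_countable_topology}"
  assumes g [measurable]: "g \<in> M \<rightarrow>\<^sub>M count_space UNIV"
  shows "integral\<^sup>L M (\<lambda>x. F (g x)) =
      integral\<^sup>L (count_space UNIV) (\<lambda>c. measure M (g -` {c} \<inter> space M) *\<^sub>R F c)" (is ?int)
    and "integrable M (\<lambda>x. F (g x)) \<longleftrightarrow>
      integrable (count_space UNIV) (\<lambda>c. measure M (g -` {c} \<inter> space M) *\<^sub>R F c)" (is ?able)
proof -
  have d: "distr M (count_space UNIV) g =
      density (count_space UNIV) (\<lambda>c. ennreal (measure M (g -` {c} \<inter> space M)))"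
  proof (rule measure_eqI_countable)
    fix c
    have "emeasure (density (count_space UNIV) (\<lambda>c. ennreal (measure M (g -` {c} \<inter> space M)))) {c} =
        ennreal (measure M (g -` {c} \<inter> space M))"
      by (simp add: emeasure_density nn_integral_indicator_singleton')
    thus "emeasure (distr M (count_space UNIV) g) {c} =
        emeasure (density (count_space UNIV) (\<lambda>c. ennreal (measure M (g -` {c} \<inter> space M)))) {c}"
      by (simp add: emeasure_distr emeasure_eq_measure)
  qed auto
  have "integral\<^sup>L (distr M (count_space UNIV) g) F = integral\<^sup>L M (\<lambda>x. F (g x))"
    by (intro integral_distr) auto
  thus ?int unfolding d by (subst (asm) integral_density) auto
  have "integrable (distr M (count_space UNIV) g) F \<longleftrightarrow> integrable M (\<lambda>x. F (g x))"
    by (intro integrable_distr_eq) auto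
  thus ?able unfolding d by (subst (asm) integrable_density) auto
qed

context ultrametric_levels
begin

lemma integral_levels:
  fixes F :: "enat \<times> enat \<times> enat \<Rightarrow> complex"
  assumes F: "\<And>k j i. k = \<infinity> \<or> j = \<infinity> \<or> i = \<infinity> \<Longrightarrow> F (k, j, i) = 0"
  shows "integral\<^sup>L (M \<Otimes>\<^sub>M M) (\<lambda>z. F (levels z)) =
      integral\<^sup>L (count_space UNIV) (\<lambda>t. triangle_weight v t *\<^sub>R F t)" (is ?int)
    and "integrable (M \<Otimes>\<^sub>M M) (\<lambda>z. F (levels z)) \<longleftrightarrow>
      integrable (count_space UNIV) (\<lambda>t. triangle_weight v t *\<^sub>R F t)" (is ?able)
proof -
  interpret P: finite_measure "M \<Otimes>\<^sub>M M" by (intro finite_measure_pair_measure finite_measure_axioms)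
  have "measure (M \<Otimes>\<^sub>M M) (levels -` {t} \<inter> space (M \<Otimes>\<^sub>M M)) *\<^sub>R F t = triangle_weight v t *\<^sub>R F t" for t
    by (cases t; cases "fst t"; cases "fst (snd t)"; cases "snd (snd t)")
       (auto simp: triangle_weight_def measure_levels F)
  hence eq: "(\<lambda>t. measure (M \<Otimes>\<^sub>M M) (levels -` {t} \<inter> space (M \<Otimes>\<^sub>M M)) *\<^sub>R F t) =
      (\<lambda>t. triangle_weight v t *\<^sub>R F t)" by blast
  show ?int ?able using P.integral_countable_image[OF levels_measurable, of F] unfolding eq .
qed

end

section \<open>The series over triangles\<close>

text \<open>For \<open>r = 1 / p\<close>, the mass of a spherical ball of level \<open>k\<close>.
  Level \<open>0\<close> is exceptional, because the whole projective line splits into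
  \<open>p + 1\<close> balls of the next level, and every smaller ball into
  \<open>p\<close>.\<close>

definition sphere_mass :: "real \<Rightarrow> nat \<Rightarrow> real" where
  "sphere_mass r k = (if k = 0 then 1 + r else r ^ k)"

lemma sphere_mass_diff:
  "sphere_mass r i - sphere_mass r (Suc i) = (if i = 0 then 1 else 1 - r) * r ^ i"
  by (auto simp: sphere_mass_def left_diff_distrib)

text \<open>Coordinates for the summation are the base level \<open>i\<close> and the excess
  \<open>Suc d\<close> of the third side. The exceptional equilateral factor at \<open>i = 0\<close>
  is \<open>1 + r - 2 * r\<close>.\<close>

lemma triangle_law_sphere_mass:
  "triangle_law (sphere_mass r) i i i =
      (if i = 0 then 1 - r else (1 - r) * (1 - 2 * r) * (r\<^sup>2) ^ i)"
  "triangle_law (sphere_mass r) (i + Suc d) i i =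
      (if i = 0 then 1 else 1 - r) * (r\<^sup>2) ^ i * ((1 - r) * r ^ Suc d)"
  "triangle_law (sphere_mass r) i (i + Suc d) i =
      (if i = 0 then 1 else 1 - r) * (r\<^sup>2) ^ i * ((1 - r) * r ^ Suc d)"
  "triangle_law (sphere_mass r) i i (i + Suc d) =
      (if i = 0 then 1 else 1 - r) * (r\<^sup>2) ^ i * ((1 - r) * r ^ Suc d)"
proof -
  have sq: "(r\<^sup>2) ^ i = r ^ i * r ^ i" by (simp add: power2_eq_square power_mult_distrib)
  have "sphere_mass r i - 2 * sphere_mass r (Suc i) = (if i = 0 then 1 - r else (1 - 2 * r) * r ^ i)"
    by (simp add: sphere_mass_def left_diff_distrib)
  thus "triangle_law (sphere_mass r) i i i =
      (if i = 0 then 1 - r else (1 - r) * (1 - 2 * r) * (r\<^sup>2) ^ i)"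
    by (simp add: triangle_law_def triangle_slice_def sphere_mass_diff sq)
  have o: "(if i = 0 then 1 else 1 - r) * r ^ i * ((1 - r) * r ^ (i + Suc d)) =
      (if i = 0 then 1 else 1 - r) * (r\<^sup>2) ^ i * ((1 - r) * r ^ Suc d)"
    unfolding sq power_add by (simp only: mult_ac)
  show "triangle_law (sphere_mass r) (i + Suc d) i i =
      (if i = 0 then 1 else 1 - r) * (r\<^sup>2) ^ i * ((1 - r) * r ^ Suc d)"
    "triangle_law (sphere_mass r) i (i + Suc d) i =
      (if i = 0 then 1 else 1 - r) * (r\<^sup>2) ^ i * ((1 - r) * r ^ Suc d)"
    "triangle_law (sphere_mass r) i i (i + Suc d) =
      (if i = 0 then 1 else 1 - r) * (r\<^sup>2) ^ i * ((1 - r) * r ^ Suc d)"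
    unfolding o[symmetric] triangle_law_def triangle_slice_def sphere_mass_diff
    by (simp_all del: power_Suc add: mult_ac)
qed

lemma triangle_law_scalene:
  assumes "\<not> (i = j \<and> i \<le> k)" "\<not> (i = k \<and> i \<le> j)" "\<not> (j = k \<and> j \<le> i)"
  shows "triangle_law v k j i = 0"
  using assms by (auto simp: triangle_law_def triangle_slice_def)

text \<open>Joint summability is a hypothesis since it is inherited from the full series over
  triples; iterated summation then factors.\<close>

lemma has_sum_prod_geometric:
  fixes u t :: "nat \<Rightarrow> complex"
  assumes "(\<lambda>(i, d). u i * t d) summable_on UNIV" "(u has_sum U) UNIV" "(t has_sum T) UNIV"
  shows "((\<lambda>(i, d). u i * t d) has_sum (U * T)) UNIV"
proof -
  have "infsum (\<lambda>(i, d). u i * t d) (UNIV \<times> UNIV) = infsum (\<lambda>i. infsum (\<lambda>d. u i * t d) UNIV) UNIV"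
    using assms(1) infsum_Sigma'_banach[of "\<lambda>i d. u i * t d" UNIV "\<lambda>_. UNIV"] by simp
  also have "\<dots> = U * T"
    using assms(2,3) by (simp add: infsum_cmult_right' infsum_cmult_left' infsumI)
  finally show ?thesis using assms(1) by (metis UNIV_Times_UNIV has_sum_infsum)
qed

text \<open>The triples of positive weight are \<open>(i, i, i)\<close> and the permutations of \<open>(i + d + 1, i, i)\<close>. Along
  each of these families the series is a product of geometric series, with ratio \<open>S\<close> in \<open>i\<close> and
  \<open>a\<close>, \<open>b\<close> or \<open>c\<close> in \<open>d\<close>.\<close>

lemma triangle_series:
  fixes A B C T :: complex and r :: real
  assumes r: "0 < r" "r < 1" and nz: "A \<noteq> 0" "B \<noteq> 0" "C \<noteq> 0"
    and sum: "((\<lambda>(k, j, i). triangle_law (sphere_mass r) k j i *\<^sub>R (A ^ k * B ^ j * C ^ i)) has_sum T) UNIV"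
  defines "a \<equiv> of_real r * A" and "b \<equiv> of_real r * B" and "c \<equiv> of_real r * C"
    and "S \<equiv> of_real (r\<^sup>2) * (A * B * C)"
  shows "norm a < 1" "norm b < 1" "norm c < 1" "norm S < 1"
    "T = (1 - of_real r) * ((1 - a * b) * (1 - b * c) * (1 - c * a)) / ((1 - S) * (1 - a) * (1 - b) * (1 - c))"
proof -
  define f where "f = (\<lambda>(k, j, i). triangle_law (sphere_mass r) k j i *\<^sub>R (A ^ k * B ^ j * C ^ i))"
  define R :: complex where "R = of_real r"
  define u where "u = (\<lambda>i::nat. (if i = 0 then 1 else 1 - R) * S ^ i)"
  define s where "s = (\<lambda>x::complex. \<lambda>d::nat. (1 - R) * x ^ Suc d)"
  define g0 where "g0 = (\<lambda>i::nat. (i, i, i))"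
  define g1 where "g1 = (\<lambda>(i::nat, d). (i + Suc d, i, i))"
  define g2 where "g2 = (\<lambda>(i::nat, d). (i, i + Suc d, i))"
  define g3 where "g3 = (\<lambda>(i::nat, d). (i, i, i + Suc d))"
  have inj: "inj g0" "inj g1" "inj g2" "inj g3"
    by (auto simp: inj_def g0_def g1_def g2_def g3_def)
  have R1: "R \<noteq> 1" "R \<noteq> 0" using r by (auto simp: R_def)
  have S_eq: "S * R = a * b * c"
    by (simp add: S_def a_def b_def c_def R_def power2_eq_square)
  have f0: "f (g0 i) = (if i = 0 then 1 - R else (1 - R) * (1 - 2 * R) * S ^ i)" for i
    by (simp add: f_def g0_def triangle_law_sphere_mass scaleR_conv_of_real S_def R_def power_mult_distrib)
  have key: "complex_of_real ((if i = 0 then 1 else 1 - r) * (r\<^sup>2) ^ i * ((1 - r) * r ^ Suc d)) *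
      (A ^ i * B ^ i * C ^ i * x ^ Suc d) = u i * s (of_real r * x) d" for i d x
    by (simp add: u_def s_def S_def R_def power_mult_distrib)
  have f1: "f \<circ> g1 = (\<lambda>(i, d). u i * s a d)"
  proof (rule ext, clarify)
    fix i d :: nat
    have "(f \<circ> g1) (i, d) = of_real (triangle_law (sphere_mass r) (i + Suc d) i i) *
        (A ^ i * B ^ i * C ^ i * A ^ Suc d)"
      by (simp add: f_def g1_def scaleR_conv_of_real power_add)
    thus "(f \<circ> g1) (i, d) = u i * s a d" unfolding triangle_law_sphere_mass key a_def .
  qed
  have f2: "f \<circ> g2 = (\<lambda>(i, d). u i * s b d)"
  proof (rule ext, clarify)
    fix i d :: nat
    have "(f \<circ> g2) (i, d) = of_real (triangle_law (sphere_mass r) i (i + Suc d) i) *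
        (A ^ i * B ^ i * C ^ i * B ^ Suc d)"
      by (simp add: f_def g2_def scaleR_conv_of_real power_add)
    thus "(f \<circ> g2) (i, d) = u i * s b d" unfolding triangle_law_sphere_mass key b_def .
  qed
  have f3: "f \<circ> g3 = (\<lambda>(i, d). u i * s c d)"
  proof (rule ext, clarify)
    fix i d :: nat
    have "(f \<circ> g3) (i, d) = of_real (triangle_law (sphere_mass r) i i (i + Suc d)) *
        (A ^ i * B ^ i * C ^ i * C ^ Suc d)"
      by (simp add: f_def g3_def scaleR_conv_of_real power_add)
    thus "(f \<circ> g3) (i, d) = u i * s c d" unfolding triangle_law_sphere_mass key c_def .
  qed
  have f: "f summable_on X" for X
    using sum unfolding f_def[symmetric] by (metis has_sum_imp_summable subset_UNIV summable_on_subset_banach)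
  have sm: "(\<lambda>(i, d). u i * s a d) summable_on UNIV" "(\<lambda>(i, d). u i * s b d) summable_on UNIV"
    "(\<lambda>(i, d). u i * s c d) summable_on UNIV"
    using f[of "range g1"] f[of "range g2"] f[of "range g3"]
    by (simp_all add: summable_on_reindex inj f1 f2 f3)
  \<comment> \<open>The row \<open>i = 0\<close>, where \<open>u 0 = 1\<close>, is a geometric
    series in \<open>x\<close>.\<close>
  have ratio: "norm x < 1" if x: "(\<lambda>(i, d). u i * s x d) summable_on UNIV" for x
  proof -
    have "inj (Pair (0::nat) :: nat \<Rightarrow> _)" by (auto simp: inj_def)
    moreover have "(\<lambda>(i, d). u i * s x d) summable_on range (Pair 0)"
      using x by (rule summable_on_subset_banach) simp
    ultimately have "(\<lambda>d. u 0 * s x d) summable_on UNIV" by (simp add: summable_on_reindex o_def)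
    hence "summable (\<lambda>d. (1 - R) * x ^ Suc d)"
      by (auto simp: u_def s_def dest!: summable_on_imp_summable)
    hence "summable (\<lambda>d. x ^ Suc d)" using R1 by (subst (asm) summable_cmult_iff) auto
    hence "summable (\<lambda>d. x ^ d)" by (subst (asm) summable_Suc_iff)
    thus ?thesis by (simp add: summable_geometric_iff)
  qed
  show abc: "norm a < 1" "norm b < 1" "norm c < 1" using ratio sm by blast+
  \<comment> \<open>The column \<open>d = 0\<close> is a nonzero multiple of \<open>u\<close>, which
    is geometric in \<open>S\<close> from its second term on.\<close>
  show S: "norm S < 1"
  proof -
    have "inj (\<lambda>i::nat. (i, 0::nat))" by (auto simp: inj_def)
    moreover have "(\<lambda>(i, d). u i * s a d) summable_on range (\<lambda>i. (i, 0))"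
      using sm(1) by (rule summable_on_subset_banach) simp
    ultimately have "(\<lambda>i. u i * s a 0) summable_on UNIV" by (simp add: summable_on_reindex o_def)
    hence "summable (\<lambda>i. s a 0 * u i)"
      by (auto dest!: summable_on_imp_summable simp: mult.commute)
    moreover have "s a 0 \<noteq> 0" using R1 nz r by (simp add: s_def a_def)
    ultimately have "summable u" by (subst (asm) summable_cmult_iff) auto
    hence "summable (\<lambda>i. u (Suc i))" by (subst summable_Suc_iff)
    hence "summable (\<lambda>i. (1 - R) * S ^ Suc i)" by (simp add: u_def)
    hence "summable (\<lambda>i. S ^ Suc i)" using R1 by (subst (asm) summable_cmult_iff) auto
    hence "summable (\<lambda>i. S ^ i)" by (subst (asm) summable_Suc_iff)
    thus ?thesis by (simp add: summable_geometric_iff)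
  qed
  have ne: "a \<noteq> 1" "b \<noteq> 1" "c \<noteq> 1" "S \<noteq> 1" using abc S by auto
  have geo: "((\<lambda>i. \<kappa> * z ^ Suc i) has_sum (\<kappa> * (z / (1 - z)))) UNIV" if "norm z < 1" for z \<kappa> :: complex
  proof (rule norm_summable_imp_has_sum)
    have "(\<lambda>i. (\<kappa> * z) * z ^ i) sums ((\<kappa> * z) * (1 / (1 - z)))"
      using that by (intro sums_mult geometric_sums)
    thus "(\<lambda>i. \<kappa> * z ^ Suc i) sums (\<kappa> * (z / (1 - z)))" by (simp add: mult_ac)
    have "summable (\<lambda>i. (norm \<kappa> * norm z) * norm z ^ i)"
      using that by (intro summable_mult summable_geometric) simp
    thus "summable (\<lambda>i. norm (\<kappa> * z ^ Suc i))" by (simp add: norm_mult norm_power mult_ac)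
  qed
  \<comment> \<open>The initial term is separate because level \<open>0\<close> breaks the geometric
    pattern, both in \<open>u\<close> and along the equilateral triples.\<close>
  have geo0: "((\<lambda>i. if i = 0 then \<kappa>0 else \<kappa> * z ^ i) has_sum (\<kappa>0 + \<kappa> * (z / (1 - z)))) UNIV"
    if "norm z < 1" for z \<kappa>0 \<kappa> :: complex
  proof -
    let ?h = "\<lambda>i::nat. if i = 0 then \<kappa>0 else \<kappa> * z ^ i"
    have "(?h has_sum (\<kappa> * (z / (1 - z)))) (range Suc)"
      using geo[OF that, of \<kappa>] by (subst has_sum_reindex) (auto simp: o_def)
    moreover have "(?h has_sum \<kappa>0) {0}" by (rule has_sum_finiteI) auto
    moreover have "{0} \<union> range Suc = (UNIV :: nat set)" by (auto simp: image_iff) (metis not0_implies_Suc)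
    ultimately show ?thesis using has_sum_Un_disjoint[of ?h "{0}" \<kappa>0 "range Suc"] by auto
  qed
  define U where "U = 1 + (1 - R) * (S / (1 - S))"
  define E where "E = (\<lambda>x. (1 - R) * (x / (1 - x)))"
  have uU: "(u has_sum U) UNIV"
  proof -
    have "u = (\<lambda>i. if i = 0 then 1 else (1 - R) * S ^ i)" by (auto simp: u_def)
    thus ?thesis using geo0[OF S, of 1 "1 - R"] by (simp add: U_def)
  qed
  have sE: "(s x has_sum E x) UNIV" if "norm x < 1" for x
    unfolding s_def E_def using geo[OF that, of "1 - R"] .
  have T0: "(f has_sum ((1 - R) + (1 - R) * (1 - 2 * R) * (S / (1 - S)))) (range g0)"
    using geo0[OF S, of "1 - R" "(1 - R) * (1 - 2 * R)"] inj(1)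
    by (simp add: has_sum_reindex o_def f0)
  have T1: "(f has_sum (U * E a)) (range g1)"
    using has_sum_prod_geometric[OF sm(1) uU sE[OF abc(1)]] by (simp add: has_sum_reindex inj f1)
  have T2: "(f has_sum (U * E b)) (range g2)"
    using has_sum_prod_geometric[OF sm(2) uU sE[OF abc(2)]] by (simp add: has_sum_reindex inj f2)
  have T3: "(f has_sum (U * E c)) (range g3)"
    using has_sum_prod_geometric[OF sm(3) uU sE[OF abc(3)]] by (simp add: has_sum_reindex inj f3)
  have "(f has_sum (((1 - R) + (1 - R) * (1 - 2 * R) * (S / (1 - S)) + U * E a) + U * E b + U * E c))
      (((range g0 \<union> range g1) \<union> range g2) \<union> range g3)"
    by (intro has_sum_Un_disjoint T0 T1 T2 T3) (auto simp: g0_def g1_def g2_def g3_def)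
  moreover have "(f has_sum T) (((range g0 \<union> range g1) \<union> range g2) \<union> range g3)"
  proof (rule has_sum_cong_neutral[THEN iffD1, OF _ _ _ sum[folded f_def]])
    fix x assume x: "x \<in> UNIV - (((range g0 \<union> range g1) \<union> range g2) \<union> range g3)"
    obtain k j i where kji: "x = (k, j, i)" by (cases x) auto
    have "\<not> (i = j \<and> i \<le> k)"
    proof
      assume *: "i = j \<and> i \<le> k"
      have "k = i \<or> k = i + Suc (k - Suc i)" using * by auto
      hence "x = g0 i \<or> x = g1 (i, k - Suc i)" using * kji by (auto simp: g0_def g1_def)
      thus False using x by blast
    qed
    moreover have "\<not> (i = k \<and> i \<le> j)"
    proof
      assume *: "i = k \<and> i \<le> j"
      have "j = i \<or> j = i + Suc (j - Suc i)" using * by auto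
      hence "x = g0 i \<or> x = g2 (i, j - Suc i)" using * kji by (auto simp: g0_def g2_def)
      thus False using x by blast
    qed
    moreover have "\<not> (j = k \<and> j \<le> i)"
    proof
      assume *: "j = k \<and> j \<le> i"
      have "i = j \<or> i = j + Suc (i - Suc j)" using * by auto
      hence "x = g0 j \<or> x = g3 (j, i - Suc j)" using * kji by (auto simp: g0_def g3_def)
      thus False using x by blast
    qed
    ultimately show "f x = 0" by (simp add: kji f_def triangle_law_scalene)
  qed auto
  ultimately have T: "T = ((1 - R) + (1 - R) * (1 - 2 * R) * (S / (1 - S)) + U * E a) + U * E b + U * E c"
    using has_sum_unique by blast
  have n0: "1 - a \<noteq> 0" "1 - b \<noteq> 0" "1 - c \<noteq> 0" "1 - S \<noteq> 0" using ne by auto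
  define K where "K = 1 / (1 - S)"
  have X: "(1 - R) + (1 - R) * (1 - 2 * R) * (S / (1 - S)) = (1 - R) * (1 - 2 * (S * R)) * K"
    using n0 by (simp add: K_def field_simps)
  have U: "U = (1 - S * R) * K" using n0 by (simp add: U_def K_def field_simps)
  have "(1 - R) * (1 - 2 * (S * R)) * K + (1 - S * R) * K * ((1 - R) * x) + (1 - S * R) * K * ((1 - R) * y) +
      (1 - S * R) * K * ((1 - R) * z) = (1 - R) * K * ((1 - 2 * (S * R)) + (1 - S * R) * (x + y + z))"
    for x y z by Groebner_Basis.algebra
  hence "T = (1 - R) * K * ((1 - 2 * (S * R)) + (1 - S * R) * (a / (1 - a) + b / (1 - b) + c / (1 - c)))"
    unfolding T X U E_def .
  \<comment> \<open>With \<open>S * R\<close> replaced by \<open>a * b * c\<close>, this is a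
    rational identity in \<open>a\<close>, \<open>b\<close>, \<open>c\<close> alone.\<close>
  also have "(1 - 2 * (S * R)) + (1 - S * R) * (a / (1 - a) + b / (1 - b) + c / (1 - c)) =
      ((1 - a * b) * (1 - b * c) * (1 - c * a)) / ((1 - a) * (1 - b) * (1 - c))"
    unfolding S_eq using n0 by (simp add: divide_simps) Groebner_Basis.algebra
  finally show "T = (1 - of_real r) * ((1 - a * b) * (1 - b * c) * (1 - c * a)) / ((1 - S) * (1 - a) * (1 - b) * (1 - c))"
    by (simp add: R_def K_def mult.assoc)
qed

section \<open>Levels of spherical distances, and the two kinds of fixed vertex\<close>

context padic_numbers
begin

text \<open>On \<open>spherical_values\<close> this is the exponent of \<open>1 / p\<close>, with
  \<open>\<infinity>\<close> for distance \<open>0\<close>. The ceiling extends it to all reals as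
  an antitone, measurable function.\<close>

definition lev :: "real \<Rightarrow> enat" where
  "lev t = (if t > 0 then enat (nat \<lceil>- log (real p) t\<rceil>) else \<infinity>)"

lemma lev_power: "lev ((1 / real p) ^ k) = enat k"
proof -
  have "log (real p) ((1 / real p) ^ k) = - real k"
    using p_gt_1 by (simp add: log_nat_power log_divide power_one_over log_inverse)
  thus ?thesis using p_gt_1 by (simp add: lev_def)
qed

lemma lev_0 [simp]: "lev 0 = \<infinity>"
  by (simp add: lev_def)

lemma lev_antimono: "s \<le> t \<Longrightarrow> lev t \<le> lev s"
proof (cases "s > 0")
  case True
  moreover assume "s \<le> t"
  ultimately have "log (real p) s \<le> log (real p) t" using p_gt_1 by simp
  hence "nat \<lceil>- log (real p) t\<rceil> \<le> nat \<lceil>- log (real p) s\<rceil>" by (intro nat_mono ceiling_mono) simp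
  thus ?thesis using True \<open>s \<le> t\<close> by (simp add: lev_def)
qed (simp add: lev_def)

lemma lev_max: "lev (max s t) = min (lev s) (lev t)"
  using lev_antimono[of s t] lev_antimono[of t s] by (simp add: max_def min_def) fastforce

lemma lev_measurable [measurable]: "lev \<in> borel \<rightarrow>\<^sub>M count_space UNIV"
  unfolding lev_def[abs_def] by measurable

definition spherical_values :: "real set" where
  "spherical_values = insert 0 (range (\<lambda>n. (1 / real p) ^ n))"

lemma lev_ge_iff:
  assumes "t \<in> spherical_values"
  shows "enat k \<le> lev t \<longleftrightarrow> t \<le> (1 / real p) ^ k"
  using assms p_gt_1 by (auto simp: spherical_values_def lev_power power_decreasing_iff)

text \<open>Distance \<open>0\<close> fits in because \<open>0 powr s = 0\<close> agrees with the
  value \<open>0\<close> given to level \<open>\<infinity>\<close>.\<close>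

lemma powr_lev:
  assumes "t \<in> spherical_values"
  shows "complex_of_real t powr s =
    (case lev t of enat n \<Rightarrow> (complex_of_real (1 / real p) powr s) ^ n | \<infinity> \<Rightarrow> 0)"
proof (cases "t = 0")
  case False
  then obtain n where n: "t = (1 / real p) ^ n" using assms by (auto simp: spherical_values_def)
  have "complex_of_real t powr s = (complex_of_real (1 / real p) powr s) ^ n"
    using p_gt_1 unfolding n
    by (simp add: powr_def Ln_of_real ln_realpow exp_of_nat_mult[symmetric] mult_ac
        flip: of_real_power of_real_divide)
  thus ?thesis unfolding n by (simp only: lev_power enat.case)
qed simp

end

context padic_haar
begin

lemma sd_commute: "x \<in> carrier Qp \<Longrightarrow> y \<in> carrier Qp \<Longrightarrow> sd x y = sd y x"
  by (simp add: sd_def D_commute mult.commute)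

lemma D_le_psi: "x \<in> carrier Qp \<Longrightarrow> y \<in> carrier Qp \<Longrightarrow> D x y \<le> max (psi x) (psi y)"
  using D_ultrametric[of x "\<zero>\<^bsub>Qp\<^esub>" y] D_commute[of y "\<zero>\<^bsub>Qp\<^esub>"] by (auto simp: psi_eq)

lemma psi_le_D: "x \<in> carrier Qp \<Longrightarrow> y \<in> carrier Qp \<Longrightarrow> psi x \<le> max (D x y) (psi y)"
  using D_ultrametric[of x y "\<zero>\<^bsub>Qp\<^esub>"] by (auto simp: psi_eq)

lemma sd_inf_value: "x \<in> carrier Qp \<Longrightarrow> 1 / psi x \<in> spherical_values"
  using psi_values[of x] by (auto simp: spherical_values_def power_one_over)

text \<open>The exponent of \<open>1 / p\<close> is a natural number because \<open>D x y\<close> is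
  at most the larger of \<open>psi x\<close> and \<open>psi y\<close>, hence at most their
  product.\<close>

lemma sd_value:
  assumes x: "x \<in> carrier Qp" and y: "y \<in> carrier Qp" shows "sd x y \<in> spherical_values"
proof (cases "D x y = 0")
  case False
  then obtain k where k: "D x y = real p powi k" using D_values[OF x y] by auto
  obtain a b :: nat where ab: "psi x = real p powi (int a)" "psi y = real p powi (int b)"
    using psi_values x y by meson
  have "max (psi x) (psi y) \<le> psi x * psi y"
    using psi_ge_1[of x] psi_ge_1[of y] by (simp add: mult_le_cancel_left1 mult_le_cancel_right1)
  hence "real p powi k \<le> psi x * psi y" using order_trans[OF D_le_psi[OF x y]] k by simp
  also have "\<dots> = real p powi (int a + int b)" using ab p_gt_1 by (simp add: power_int_add)
  finally have "real p powi k \<le> real p powi (int a + int b)" .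
  hence kab: "k \<le> int a + int b" by (simp only: p_powi_le_iff)
  define n where "n = nat (int a + int b - k)"
  have kn: "k = int a + int b - int n" using kab by (simp add: n_def)
  have "sd x y = (1 / real p) ^ n"
    using p_gt_1 unfolding sd_def k ab kn
    by (simp add: power_int_diff power_int_add power_one_over field_simps)
  thus ?thesis by (simp add: spherical_values_def)
qed (simp add: sd_def spherical_values_def)

text \<open>Case distinction on norms replaces the identity \<open>(x - z) (y, 1) = (x - y) (z, 1) + (y - z) (x, 1)\<close>,
  so that multiplicativity of the norm is not used.\<close>

lemma sd_ultrametric:
  assumes c: "x \<in> carrier Qp" "y \<in> carrier Qp" "z \<in> carrier Qp"
  shows "sd x z \<le> max (sd x y) (sd y z)"
proof -
  \<comment> \<open>Denominators are cleared. By ultrametricity of \<open>D\<close>, either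
    \<open>D x z \<le> D x y\<close> or \<open>D x z \<le> D y z\<close>; the second case becomes
    the first on exchanging \<open>x\<close> and \<open>z\<close>.\<close>
  have main: "D x z * psi y \<le> max (D x y * psi z) (D y z * psi x)"
    if c: "x \<in> carrier Qp" "y \<in> carrier Qp" "z \<in> carrier Qp" and le: "D x z \<le> D x y" for x y z
  proof (cases "psi y \<le> psi z")
    case True
    thus ?thesis using mult_mono[OF le True] D_nonneg[OF c(1,2)] psi_pos[of y] by (simp add: le_max_iff_disj less_imp_le)
  next
    case False
    have far: "D u w = psi u" if "u \<in> carrier Qp" "w \<in> carrier Qp" "psi w < psi u" for u w
      using D_le_psi[of u w] psi_le_D[of u w] that by (auto simp: max_def split: if_splits)
    have yz: "D y z = psi y" using far[of y z] False c by simp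
    show ?thesis
    proof (cases "D x z \<le> psi x")
      case True
      thus ?thesis using mult_right_mono[OF True, of "psi y"] psi_pos[of y] yz
        by (simp add: le_max_iff_disj mult.commute)
    next
      case nle: False
      have xz: "psi x < psi z" and "D x z \<le> psi z" using D_le_psi[OF c(1,3)] nle by auto
      moreover have "D x y = psi y" using far[of y x] xz False c D_commute[of x y] by simp
      ultimately show ?thesis using psi_pos[of y] mult_right_mono[of "D x z" "psi z" "psi y"]
        by (simp add: le_max_iff_disj mult.commute)
    qed
  qed
  have "D x z * psi y \<le> max (D x y * psi z) (D y z * psi x)"
  proof (cases "D x z \<le> D x y")
    case True thus ?thesis using main c by blast
  next
    case False
    hence "D z x \<le> D z y" using D_ultrametric[OF c] D_commute c by auto
    from main[OF c(3,2,1) this] show ?thesis using c D_commute by (simp add: max.commute)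
  qed
  moreover have "0 < psi x * psi y * psi z" by simp
  ultimately have "D x z * psi y / (psi x * psi y * psi z) \<le> max (D x y * psi z) (D y z * psi x) / (psi x * psi y * psi z)"
    by (intro divide_right_mono[OF _ less_imp_le])
  also have "\<dots> = max (D x y * psi z / (psi x * psi y * psi z)) (D y z * psi x / (psi x * psi y * psi z))"
    unfolding max_divide_distrib_right if_P[OF less_imp_le[OF \<open>0 < psi x * psi y * psi z\<close>]] ..
  finally show ?thesis
    using psi_pos[of x] psi_pos[of y] psi_pos[of z] by (simp add: sd_def mult_ac less_imp_neq[symmetric])
qed

text \<open>The triangle inequality with infinity as a vertex; multiplied by
  \<open>psi x * psi y\<close>, its two forms are \<open>D_le_psi\<close> and
  \<open>psi_le_D\<close>.\<close>

lemma sd_ultrametric_inf: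
  assumes c: "x \<in> carrier Qp" "y \<in> carrier Qp"
  shows "sd x y \<le> max (1 / psi x) (1 / psi y)" "1 / psi x \<le> max (sd x y) (1 / psi y)"
proof -
  have P: "psi x > 0" "psi y > 0" by simp_all
  note PP = less_imp_le[OF mult_pos_pos[OF P]]
  have "D x y / (psi x * psi y) \<le> max (psi x) (psi y) / (psi x * psi y)"
    by (rule divide_right_mono[OF D_le_psi[OF c] PP])
  also have "\<dots> = max (1 / psi x) (1 / psi y)"
    unfolding max_divide_distrib_right if_P[OF PP] by (simp add: max.commute)
  finally show "sd x y \<le> max (1 / psi x) (1 / psi y)" by (simp add: sd_def)
  have "1 / psi x = psi y / (psi x * psi y)" by simp
  also have "\<dots> \<le> max (D x y) (psi x) / (psi x * psi y)"
    using psi_le_D[OF c(2,1)] D_commute[OF c]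
    by (intro divide_right_mono[OF _ PP]) simp
  also have "\<dots> = max (sd x y) (1 / psi y)"
    unfolding max_divide_distrib_right if_P[OF PP] by (simp add: sd_def)
  finally show "1 / psi x \<le> max (sd x y) (1 / psi y)" .
qed

lemma sd_measurable [measurable]: "(\<lambda>z. sd (fst z) (snd z)) \<in> borel_measurable (\<mu> \<Otimes>\<^sub>M \<mu>)"
  unfolding sd_def by measurable

lemma sd_measurable1 [measurable]: "y \<in> carrier Qp \<Longrightarrow> (\<lambda>x. sd x y) \<in> borel_measurable \<mu>"
  unfolding sd_def by measurable

lemma sets_sm_pair [measurable_cong]: "sets (sm \<Otimes>\<^sub>M sm) = sets (\<mu> \<Otimes>\<^sub>M \<mu>)"
  by (intro sets_pair_measure_cong sets_sm)

lemma measure_sm_space: "measure sm (carrier Qp) = 1 + 1 / real p"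
  unfolding measure_def emeasure_sm_space by (rule enn2real_ennreal) simp

lemma measure_sd_ball:
  assumes y: "y \<in> carrier Qp"
  shows "measure sm {x \<in> carrier Qp. sd x y \<le> (1 / real p) ^ k} = sphere_mass (1 / real p) k"
proof (cases "k = 0")
  case True
  have "sd x y \<le> 1" if "x \<in> carrier Qp" for x
    using sd_value[OF that y] p_gt_1 by (auto simp: spherical_values_def power_le_one)
  hence "{x \<in> carrier Qp. sd x y \<le> (1 / real p) ^ k} = carrier Qp" using True by auto
  thus ?thesis using True by (simp add: measure_sm_space sphere_mass_def)
next
  case False
  thus ?thesis using emeasure_sd_ball[OF y, of k] p_gt_1 by (simp add: measure_def sphere_mass_def)
qed

lemma measure_inf_ball:
  "measure sm {x \<in> carrier Qp. 1 / psi x \<le> (1 / real p) ^ k} = sphere_mass (1 / real p) k"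
proof (cases "k = 0")
  case True
  hence "{x \<in> carrier Qp. 1 / psi x \<le> (1 / real p) ^ k} = carrier Qp"
    using psi_ge_1 by (auto simp: divide_le_eq_1)
  thus ?thesis using True by (simp add: measure_sm_space sphere_mass_def)
next
  case False
  define R where "R = real p ^ k"
  have R: "R > 1" using p_gt_1 False by (simp add: R_def one_less_power)
  have "1 / psi x \<le> (1 / real p) ^ k \<longleftrightarrow> real p ^ k \<le> D x \<zero>\<^bsub>Qp\<^esub>" if "x \<in> carrier Qp" for x
  proof -
    have "1 / psi x \<le> 1 / R \<longleftrightarrow> R \<le> psi x" using R psi_pos[of x] by (simp add: field_simps)
    thus ?thesis using R that by (auto simp: psi_eq power_one_over R_def)
  qed
  hence "{x \<in> carrier Qp. 1 / psi x \<le> (1 / real p) ^ k} = inf_ball k" by (auto simp: inf_ball_def)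
  thus ?thesis using emeasure_sm_inf_ball[of k] False p_gt_1 by (simp add: measure_def sphere_mass_def)
qed

lemma lev_sd_measurable: "(\<lambda>z. lev (sd (fst z) (snd z))) \<in> sm \<Otimes>\<^sub>M sm \<rightarrow>\<^sub>M count_space UNIV"
  by measurable

lemma ultrametric_levels_point:
  assumes b: "b \<in> carrier Qp"
  shows "ultrametric_levels sm (\<lambda>x y. lev (sd x y)) (\<lambda>x. lev (sd x b)) (sphere_mass (1 / real p))"
proof
  show "(\<lambda>x. lev (sd x b)) \<in> sm \<rightarrow>\<^sub>M count_space UNIV" using b by measurable
next
  fix x y assume "x \<in> space sm" "y \<in> space sm"
  hence c: "x \<in> carrier Qp" "y \<in> carrier Qp" by simp_all
  note u = sd_ultrametric[of x b y] sd_ultrametric[of y x b] sd_ultrametric[of x y b]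
  show "min (lev (sd x b)) (lev (sd y b)) \<le> lev (sd x y)"
    "min (lev (sd x y)) (lev (sd x b)) \<le> lev (sd y b)"
    "min (lev (sd x y)) (lev (sd y b)) \<le> lev (sd x b)"
    unfolding lev_max[symmetric] using u c b sd_commute[of x y] sd_commute[of y b]
    by (auto intro!: lev_antimono)
next
  fix x k assume "x \<in> space sm"
  hence x: "x \<in> carrier Qp" by simp
  have "{y \<in> space sm. enat k \<le> lev (sd x y)} = {y \<in> carrier Qp. sd y x \<le> (1 / real p) ^ k}"
    using x lev_ge_iff sd_value sd_commute by auto
  thus "measure sm {y \<in> space sm. enat k \<le> lev (sd x y)} = sphere_mass (1 / real p) k"
    using measure_sd_ball[OF x] by simp
next
  fix k
  have "{y \<in> space sm. enat k \<le> lev (sd y b)} = {y \<in> carrier Qp. sd y b \<le> (1 / real p) ^ k}"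
    using b lev_ge_iff sd_value by auto
  thus "measure sm {y \<in> space sm. enat k \<le> lev (sd y b)} = sphere_mass (1 / real p) k"
    using measure_sd_ball[OF b] by simp
qed (rule lev_sd_measurable)

text \<open>The mass function is the same as in \<open>ultrametric_levels_point\<close>: this is why
  both integrals lead to one series.\<close>

lemma ultrametric_levels_infinity:
  "ultrametric_levels sm (\<lambda>x y. lev (sd x y)) (\<lambda>x. lev (1 / psi x)) (sphere_mass (1 / real p))"
proof
  show "(\<lambda>x. lev (1 / psi x)) \<in> sm \<rightarrow>\<^sub>M count_space UNIV" by measurable
next
  fix x y assume "x \<in> space sm" "y \<in> space sm"
  hence c: "x \<in> carrier Qp" "y \<in> carrier Qp" by simp_all
  show "min (lev (1 / psi x)) (lev (1 / psi y)) \<le> lev (sd x y)"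
    "min (lev (sd x y)) (lev (1 / psi x)) \<le> lev (1 / psi y)"
    "min (lev (sd x y)) (lev (1 / psi y)) \<le> lev (1 / psi x)"
    unfolding lev_max[symmetric]
    using sd_ultrametric_inf[of x y] sd_ultrametric_inf[of y x] c sd_commute[of x y]
    by (auto intro!: lev_antimono)
next
  fix x k assume "x \<in> space sm"
  hence x: "x \<in> carrier Qp" by simp
  have "{y \<in> space sm. enat k \<le> lev (sd x y)} = {y \<in> carrier Qp. sd y x \<le> (1 / real p) ^ k}"
    using x lev_ge_iff sd_value sd_commute by auto
  thus "measure sm {y \<in> space sm. enat k \<le> lev (sd x y)} = sphere_mass (1 / real p) k"
    using measure_sd_ball[OF x] by simp
next
  fix k
  have "{y \<in> space sm. enat k \<le> lev (1 / psi y)} = {y \<in> carrier Qp. 1 / psi y \<le> (1 / real p) ^ k}"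
    using lev_ge_iff sd_inf_value by auto
  thus "measure sm {y \<in> space sm. enat k \<le> lev (1 / psi y)} = sphere_mass (1 / real p) k"
    using measure_inf_ball by simp
qed (rule lev_sd_measurable)

end

section \<open>Evaluation of the integrals\<close>

context padic_haar
begin

lemma sm_pair_density:
  "sm \<Otimes>\<^sub>M sm = density (\<mu> \<Otimes>\<^sub>M \<mu>) (\<lambda>z. ennreal (1 / (psi (fst z))\<^sup>2 * (1 / (psi (snd z))\<^sup>2)))"
proof -
  have "sigma_finite_measure sm" by (rule sm.sigma_finite_measure_axioms)
  hence "sm \<Otimes>\<^sub>M sm = density (\<mu> \<Otimes>\<^sub>M \<mu>) (\<lambda>(x, y). ennreal (1 / (psi x)\<^sup>2) * ennreal (1 / (psi y)\<^sup>2))"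
    unfolding sm_def by (intro pair_measure_density sigma_finite_measure_axioms) auto
  also have "(\<lambda>(x, y). ennreal (1 / (psi x)\<^sup>2) * ennreal (1 / (psi y)\<^sup>2)) =
      (\<lambda>z. ennreal (1 / (psi (fst z))\<^sup>2 * (1 / (psi (snd z))\<^sup>2)))"
    unfolding case_prod_beta' by (intro ext ennreal_mult[symmetric]) auto
  finally show ?thesis .
qed

lemma integral_sm_pair:
  fixes h :: "padic \<times> padic \<Rightarrow> complex"
  assumes h: "h \<in> borel_measurable (\<mu> \<Otimes>\<^sub>M \<mu>)"
  shows "integral\<^sup>L (\<mu> \<Otimes>\<^sub>M \<mu>) (\<lambda>z. (1 / (psi (fst z))\<^sup>2 * (1 / (psi (snd z))\<^sup>2)) *\<^sub>R h z) = integral\<^sup>L (sm \<Otimes>\<^sub>M sm) h"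
    and "integrable (\<mu> \<Otimes>\<^sub>M \<mu>) (\<lambda>z. (1 / (psi (fst z))\<^sup>2 * (1 / (psi (snd z))\<^sup>2)) *\<^sub>R h z) \<longleftrightarrow> integrable (sm \<Otimes>\<^sub>M sm) h"
proof -
  have g: "(\<lambda>z. 1 / (psi (fst z))\<^sup>2 * (1 / (psi (snd z))\<^sup>2)) \<in> borel_measurable (\<mu> \<Otimes>\<^sub>M \<mu>)"
    by measurable
  have nn: "AE z in \<mu> \<Otimes>\<^sub>M \<mu>. 0 \<le> 1 / (psi (fst z))\<^sup>2 * (1 / (psi (snd z))\<^sup>2)" by simp
  show "integral\<^sup>L (\<mu> \<Otimes>\<^sub>M \<mu>) (\<lambda>z. (1 / (psi (fst z))\<^sup>2 * (1 / (psi (snd z))\<^sup>2)) *\<^sub>R h z) = integral\<^sup>L (sm \<Otimes>\<^sub>M sm) h"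
    unfolding sm_pair_density using integral_density[OF h g nn] by simp
  show "integrable (\<mu> \<Otimes>\<^sub>M \<mu>) (\<lambda>z. (1 / (psi (fst z))\<^sup>2 * (1 / (psi (snd z))\<^sup>2)) *\<^sub>R h z) \<longleftrightarrow> integrable (sm \<Otimes>\<^sub>M sm) h"
    unfolding sm_pair_density using integrable_density[OF h g nn] by simp
qed

lemma integral_inverse_psi_square:
  "integral\<^sup>L \<mu> (\<lambda>x. (1 / (psi x)\<^sup>2) *\<^sub>R (t::complex)) = (1 + 1 / of_nat p) * t"
proof -
  have "integral\<^sup>L sm (\<lambda>x. t) = integral\<^sup>L \<mu> (\<lambda>x. (1 / (psi x)\<^sup>2) *\<^sub>R t)"
    unfolding sm_def by (rule integral_density) auto
  moreover have "integral\<^sup>L sm (\<lambda>x. t) = measure sm (carrier Qp) *\<^sub>R t"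
    by simp
  ultimately show ?thesis by (simp add: measure_sm_space scaleR_conv_of_real)
qed

definition level_power :: "complex \<Rightarrow> enat \<Rightarrow> complex" where
  "level_power s k = (case k of enat n \<Rightarrow> (complex_of_real (1 / real p) powr s) ^ n | \<infinity> \<Rightarrow> 0)"

lemma powr_level_power: "t \<in> spherical_values \<Longrightarrow> complex_of_real t powr s = level_power s (lev t)"
  unfolding level_power_def by (rule powr_lev)

lemma level_power_infinity [simp]: "level_power s \<infinity> = 0"
  by (simp add: level_power_def)

text \<open>Each exponent carries the label of the vertex opposite to its side; the order is that of
  the triple \<open>(k, j, i)\<close> with vertex \<open>3\<close> fixed.\<close>

definition triangle_integrand :: "complex \<Rightarrow> complex \<Rightarrow> complex \<Rightarrow> enat \<times> enat \<times> enat \<Rightarrow> complex" where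
  "triangle_integrand s\<^sub>3 s\<^sub>1 s\<^sub>2 t = level_power s\<^sub>3 (fst t) * level_power s\<^sub>1 (fst (snd t)) * level_power s\<^sub>2 (snd (snd t))"

definition triangle_integral :: "complex \<Rightarrow> complex \<Rightarrow> complex \<Rightarrow> complex" where
  "triangle_integral s\<^sub>3 s\<^sub>1 s\<^sub>2 = integral\<^sup>L (count_space UNIV)
     (\<lambda>t. triangle_weight (sphere_mass (1 / real p)) t *\<^sub>R triangle_integrand s\<^sub>3 s\<^sub>1 s\<^sub>2 t)"

lemma triangle_weight_rotate: "triangle_weight v (j, i, k) = triangle_weight v (k, j, i)"
  by (cases k; cases j; cases i) (auto simp: triangle_weight_def triangle_law_rotate)

text \<open>Vertex \<open>1\<close> is held fixed when evaluating \<open>I_padic\<close>, and vertex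
  \<open>3\<close>, sent to infinity, for \<open>I_tilde_padic\<close>; the rotation reconciles the
  two.\<close>

lemma triangle_integral_rotate: "triangle_integral s\<^sub>1 s\<^sub>2 s\<^sub>3 = triangle_integral s\<^sub>3 s\<^sub>1 s\<^sub>2"
proof -
  let ?g = "\<lambda>(k, j, i). (j, i, k) :: enat \<times> enat \<times> enat"
  let ?f = "\<lambda>t. triangle_weight (sphere_mass (1 / real p)) t *\<^sub>R triangle_integrand s\<^sub>1 s\<^sub>2 s\<^sub>3 t"
  have "bij ?g" by (rule bijI') auto
  hence "integral\<^sup>L (count_space UNIV) (\<lambda>t. ?f (?g t)) = integral\<^sup>L (count_space UNIV) ?f"
    by (rule integral_bij_count_space)
  moreover have "?f (?g t) = triangle_weight (sphere_mass (1 / real p)) t *\<^sub>R triangle_integrand s\<^sub>3 s\<^sub>1 s\<^sub>2 t" for t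
    by (cases t) (simp add: triangle_weight_rotate triangle_integrand_def mult_ac)
  ultimately show ?thesis by (simp add: triangle_integral_def)
qed

lemma triangle_integral_levels:
  fixes s\<^sub>1 s\<^sub>2 s\<^sub>3 :: complex
  assumes U: "ultrametric_levels sm (\<lambda>x y. lev (sd x y)) e (sphere_mass (1 / real p))"
  defines "h \<equiv> \<lambda>z. (1 / (psi (fst z))\<^sup>2 * (1 / (psi (snd z))\<^sup>2)) *\<^sub>R
      triangle_integrand s\<^sub>3 s\<^sub>1 s\<^sub>2 (lev (sd (fst z) (snd z)), e (snd z), e (fst z))"
  shows "integral\<^sup>L (\<mu> \<Otimes>\<^sub>M \<mu>) h = triangle_integral s\<^sub>3 s\<^sub>1 s\<^sub>2" (is ?int)
    and "integrable (\<mu> \<Otimes>\<^sub>M \<mu>) h \<longleftrightarrow> integrable (count_space UNIV)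
      (\<lambda>t. triangle_weight (sphere_mass (1 / real p)) t *\<^sub>R triangle_integrand s\<^sub>3 s\<^sub>1 s\<^sub>2 t)" (is ?able)
proof -
  interpret U: ultrametric_levels sm "\<lambda>x y. lev (sd x y)" e "sphere_mass (1 / real p)" by (rule U)
  have F: "triangle_integrand s\<^sub>3 s\<^sub>1 s\<^sub>2 (k, j, i) = 0" if "k = \<infinity> \<or> j = \<infinity> \<or> i = \<infinity>" for k j i
    using that by (auto simp: triangle_integrand_def)
  have "(\<lambda>z. triangle_integrand s\<^sub>3 s\<^sub>1 s\<^sub>2 (U.levels z)) \<in> borel_measurable (sm \<Otimes>\<^sub>M sm)"
    by measurable
  hence m: "(\<lambda>z. triangle_integrand s\<^sub>3 s\<^sub>1 s\<^sub>2 (U.levels z)) \<in> borel_measurable (\<mu> \<Otimes>\<^sub>M \<mu>)"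
    by (simp add: measurable_cong_sets[OF sets_sm_pair refl])
  show ?int ?able
    using integral_sm_pair[OF m] U.integral_levels[of "triangle_integrand s\<^sub>3 s\<^sub>1 s\<^sub>2", OF F]
    unfolding h_def U.levels_def triangle_integral_def by simp_all
qed

text \<open>The powers of \<open>1 / p\<close> coming from the masses absorb the \<open>- 1\<close>
  in the exponents: \<open>a\<close> is \<open>p\<close> to the power
  \<open>- 1 + (1 + \<nu>\<^sub>3)\<close>, and \<open>S\<close> is \<open>p\<close> to the power
  \<open>- 2 + (3 + \<nu>\<^sub>1 + \<nu>\<^sub>2 + \<nu>\<^sub>3)\<close>.\<close>

lemma triangle_integral_value:
  fixes \<nu>\<^sub>1 \<nu>\<^sub>2 \<nu>\<^sub>3 :: complex
  defines "a \<equiv> of_nat p powr \<nu>\<^sub>3" and "b \<equiv> of_nat p powr \<nu>\<^sub>1" and "c \<equiv> of_nat p powr \<nu>\<^sub>2"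
    and "S \<equiv> of_nat p powr (1 + \<nu>\<^sub>1 + \<nu>\<^sub>2 + \<nu>\<^sub>3)"
  assumes able: "integrable (count_space UNIV) (\<lambda>t. triangle_weight (sphere_mass (1 / real p)) t *\<^sub>R
      triangle_integrand (- 1 - \<nu>\<^sub>3) (- 1 - \<nu>\<^sub>1) (- 1 - \<nu>\<^sub>2) t)"
  shows "triangle_integral (- 1 - \<nu>\<^sub>3) (- 1 - \<nu>\<^sub>1) (- 1 - \<nu>\<^sub>2) =
    (1 - 1 / of_nat p) * ((1 - a * b) * (1 - b * c) * (1 - c * a)) / ((1 - S) * (1 - a) * (1 - b) * (1 - c))"
proof -
  let ?r = "1 / real p"
  let ?Z = "\<lambda>s. complex_of_real ?r powr s"
  let ?G = "\<lambda>t. triangle_weight (sphere_mass ?r) t *\<^sub>R triangle_integrand (- 1 - \<nu>\<^sub>3) (- 1 - \<nu>\<^sub>1) (- 1 - \<nu>\<^sub>2) t"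
  let ?T = "triangle_integral (- 1 - \<nu>\<^sub>3) (- 1 - \<nu>\<^sub>1) (- 1 - \<nu>\<^sub>2)"
  let ?g = "\<lambda>(k, j, i). (enat k, enat j, enat i)"
  \<comment> \<open>The integral over counting measure is restated with \<open>has_sum\<close>, so
    that it can be reindexed by triples of finite levels.\<close>
  have as: "Infinite_Set_Sum.abs_summable_on ?G UNIV" using able by (simp add: abs_summable_on_def)
  have T: "infsum ?G UNIV = ?T"
    using infsetsum_infsum[OF as] by (simp add: infsetsum_def triangle_integral_def)
  have "?G summable_on UNIV"
    using as abs_summable_equivalent abs_summable_summable by blast
  hence "(?G has_sum infsum ?G UNIV) UNIV" by (rule has_sum_infsum)
  hence "(?G has_sum ?T) UNIV" unfolding T .
  hence "(?G has_sum ?T) (range ?g)"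
  proof (rule has_sum_cong_neutral[THEN iffD1, rotated 3])
    fix t assume t: "t \<in> UNIV - range ?g"
    obtain k j i where kji: "t = (k, j, i)" by (cases t) auto
    show "?G t = 0"
    proof (rule ccontr)
      assume "?G t \<noteq> 0"
      then obtain k' j' i' where "k = enat k'" "j = enat j'" "i = enat i'"
        by (cases k; cases j; cases i) (auto simp: kji triangle_weight_def)
      hence "t = ?g (k', j', i')" by (simp add: kji)
      thus False using t by blast
    qed
  qed auto
  moreover have "inj ?g" by (auto simp: inj_def)
  ultimately have "(?G \<circ> ?g has_sum ?T) UNIV" by (simp add: has_sum_reindex)
  moreover have "?G \<circ> ?g = (\<lambda>(k, j, i). triangle_law (sphere_mass ?r) k j i *\<^sub>R
      (?Z (- 1 - \<nu>\<^sub>3) ^ k * ?Z (- 1 - \<nu>\<^sub>1) ^ j * ?Z (- 1 - \<nu>\<^sub>2) ^ i))"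
    by (auto simp: fun_eq_iff triangle_weight_def triangle_integrand_def level_power_def)
  ultimately have sum: "((\<lambda>(k, j, i). triangle_law (sphere_mass ?r) k j i *\<^sub>R
      (?Z (- 1 - \<nu>\<^sub>3) ^ k * ?Z (- 1 - \<nu>\<^sub>1) ^ j * ?Z (- 1 - \<nu>\<^sub>2) ^ i)) has_sum ?T) UNIV" by simp
  have p0: "(of_nat p :: complex) \<noteq> 0" using p_gt_1 by auto
  have Z: "?Z s = of_nat p powr (- s)" for s
  proof -
    have "Ln (complex_of_real ?r) = - Ln (of_nat p)"
      using p_gt_1 Ln_of_real[of ?r] Ln_of_real[of "real p"] by (simp add: ln_div)
    thus ?thesis using p0 by (simp add: powr_def)
  qed
  have rZ: "of_real ?r * ?Z (- 1 - \<nu>) = of_nat p powr \<nu>" for \<nu>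
    unfolding Z using p0 by (simp add: powr_add)
  have SZ: "of_real (?r\<^sup>2) * (?Z (- 1 - \<nu>\<^sub>3) * ?Z (- 1 - \<nu>\<^sub>1) * ?Z (- 1 - \<nu>\<^sub>2)) = S"
    unfolding Z S_def using p0 by (simp add: powr_add power2_eq_square)
  have nz: "?Z s \<noteq> 0" for s using p0 by simp
  have r: "0 < ?r" "?r < 1" using p_gt_1 by auto
  show ?thesis
    using triangle_series(5)[OF r nz nz nz sum] unfolding rZ SZ a_def b_def c_def by simp
qed

lemma powr_sd:
  assumes "x \<in> carrier Qp" "y \<in> carrier Qp"
  shows "complex_of_real (norm_p (x \<ominus>\<^bsub>Qp\<^esub> y)) powr s =
    complex_of_real (psi x) powr s * complex_of_real (psi y) powr s * complex_of_real (sd x y) powr s"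
proof (cases "D x y = 0")
  case False
  hence D: "D x y > 0" using D_nonneg[OF assms] by simp
  have P: "psi x > 0" "psi y > 0" by simp_all
  have "ln (D x y) = ln (psi x) + ln (psi y) + ln (sd x y)"
    using D P by (simp add: sd_def ln_div ln_mult)
  moreover have "sd x y > 0" using D P by (simp add: sd_def)
  ultimately show ?thesis using D P
    by (simp add: D_def[symmetric] powr_def Ln_of_real exp_add[symmetric] distrib_left)
qed (simp add: D_def sd_def)

lemma psi_powr_minus_2: "complex_of_real (psi x) powr (- 2) = complex_of_real (1 / (psi x)\<^sup>2)"
proof -
  have "psi x \<noteq> 0" using psi_pos[of x] by simp
  thus ?thesis by (simp add: powr_minus powr_numeral inverse_eq_divide)
qed

context
  fixes \<sigma>\<^sub>1 \<sigma>\<^sub>2 \<sigma>\<^sub>3 \<nu>\<^sub>1 \<nu>\<^sub>2 \<nu>\<^sub>3 :: complex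
  assumes \<nu>: "\<nu>\<^sub>1 = \<sigma>\<^sub>1 - \<sigma>\<^sub>2 - \<sigma>\<^sub>3" "\<nu>\<^sub>2 = \<sigma>\<^sub>2 - \<sigma>\<^sub>3 - \<sigma>\<^sub>1" "\<nu>\<^sub>3 = \<sigma>\<^sub>3 - \<sigma>\<^sub>1 - \<sigma>\<^sub>2"
begin

text \<open>Here the choice of the \<open>\<nu>\<^sub>i\<close> enters: the powers of \<open>psi\<close> left over by the spherical distances
  combine to the density of \<open>sm\<close>.\<close>

lemma psi_powr_combine:
  "complex_of_real (psi x) powr (- 2 * \<sigma>\<^sub>1) * complex_of_real (psi x) powr (- 1 - \<nu>\<^sub>3) *
     complex_of_real (psi x) powr (- 1 - \<nu>\<^sub>2) = complex_of_real (1 / (psi x)\<^sup>2)"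
  "complex_of_real (psi x) powr (- 2 * \<sigma>\<^sub>2) * complex_of_real (psi x) powr (- 1 - \<nu>\<^sub>3) *
     complex_of_real (psi x) powr (- 1 - \<nu>\<^sub>1) = complex_of_real (1 / (psi x)\<^sup>2)"
  "complex_of_real (psi x) powr (- 2 * \<sigma>\<^sub>3) * complex_of_real (psi x) powr (- 1 - \<nu>\<^sub>1) *
     complex_of_real (psi x) powr (- 1 - \<nu>\<^sub>2) = complex_of_real (1 / (psi x)\<^sup>2)"
  unfolding powr_add[symmetric] psi_powr_minus_2[symmetric] by (simp_all add: \<nu>)

lemma I_tilde_integrand_levels:
  assumes "x \<in> carrier Qp" "y \<in> carrier Qp"
  shows "I_tilde_integrand p \<sigma>\<^sub>1 \<sigma>\<^sub>2 \<sigma>\<^sub>3 (x, y) = (1 / (psi x)\<^sup>2 * (1 / (psi y)\<^sup>2)) *\<^sub>R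
    triangle_integrand (- 1 - \<nu>\<^sub>3) (- 1 - \<nu>\<^sub>1) (- 1 - \<nu>\<^sub>2) (lev (sd x y), lev (1 / psi y), lev (1 / psi x))"
proof -
  define P where "P z s = complex_of_real (psi z) powr s" for z s
  have inv: "P z s * level_power s (lev (1 / psi z)) = 1" if "z \<in> carrier Qp" for z s
  proof -
    have pz: "psi z > 0" by simp
    have "complex_of_real (1 / psi z) powr s = inverse (P z s)"
      using pz Ln_of_real[of "psi z"] Ln_of_real[of "1 / psi z"]
      by (simp add: P_def powr_def ln_div exp_minus)
    moreover have "P z s \<noteq> 0" using pz by (simp add: P_def)
    moreover note powr_level_power[OF sd_inf_value[OF that], of s]
    ultimately show ?thesis by (metis right_inverse)
  qed
  have "I_tilde_integrand p \<sigma>\<^sub>1 \<sigma>\<^sub>2 \<sigma>\<^sub>3 (x, y) =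
      P x (- 2 * \<sigma>\<^sub>1) * P y (- 2 * \<sigma>\<^sub>2) * (P x (- 1 - \<nu>\<^sub>3) * P y (- 1 - \<nu>\<^sub>3) * level_power (- 1 - \<nu>\<^sub>3) (lev (sd x y)))"
    unfolding I_tilde_integrand_def P_def Let_def prod.case \<nu>(3)[symmetric] powr_sd[OF assms]
      powr_level_power[OF sd_value[OF assms]] ..
  \<comment> \<open>Two factors equal to \<open>1\<close> are inserted. They supply the distances of
    \<open>x\<close> and \<open>y\<close> to infinity, along with the powers of \<open>psi\<close>
    needed for the density of \<open>sm\<close>.\<close>
  also have "\<dots> = P x (- 2 * \<sigma>\<^sub>1) * P y (- 2 * \<sigma>\<^sub>2) * (P x (- 1 - \<nu>\<^sub>3) * P y (- 1 - \<nu>\<^sub>3) * level_power (- 1 - \<nu>\<^sub>3) (lev (sd x y))) *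
      (P x (- 1 - \<nu>\<^sub>2) * level_power (- 1 - \<nu>\<^sub>2) (lev (1 / psi x))) *
      (P y (- 1 - \<nu>\<^sub>1) * level_power (- 1 - \<nu>\<^sub>1) (lev (1 / psi y)))"
    using assms by (simp only: inv mult_1_right)
  also have "\<dots> = (P x (- 2 * \<sigma>\<^sub>1) * P x (- 1 - \<nu>\<^sub>3) * P x (- 1 - \<nu>\<^sub>2)) * (P y (- 2 * \<sigma>\<^sub>2) * P y (- 1 - \<nu>\<^sub>3) * P y (- 1 - \<nu>\<^sub>1)) *
      triangle_integrand (- 1 - \<nu>\<^sub>3) (- 1 - \<nu>\<^sub>1) (- 1 - \<nu>\<^sub>2) (lev (sd x y), lev (1 / psi y), lev (1 / psi x))"
    by (simp only: triangle_integrand_def fst_conv snd_conv mult_ac)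
  finally show ?thesis unfolding P_def psi_powr_combine by (simp add: scaleR_conv_of_real)
qed

lemma I_integrand_levels:
  assumes "x \<in> carrier Qp" "y \<in> carrier Qp" "z \<in> carrier Qp"
  shows "I_integrand p \<sigma>\<^sub>1 \<sigma>\<^sub>2 \<sigma>\<^sub>3 (x, y, z) = (1 / (psi x)\<^sup>2) *\<^sub>R (1 / (psi y)\<^sup>2 * (1 / (psi z)\<^sup>2)) *\<^sub>R
    triangle_integrand (- 1 - \<nu>\<^sub>1) (- 1 - \<nu>\<^sub>2) (- 1 - \<nu>\<^sub>3) (lev (sd y z), lev (sd z x), lev (sd y x))"
proof -
  define P where "P z s = complex_of_real (psi z) powr s" for z s
  have "I_integrand p \<sigma>\<^sub>1 \<sigma>\<^sub>2 \<sigma>\<^sub>3 (x, y, z) =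
      P x (- 2 * \<sigma>\<^sub>1) * P y (- 2 * \<sigma>\<^sub>2) * P z (- 2 * \<sigma>\<^sub>3) *
      (P x (- 1 - \<nu>\<^sub>3) * P y (- 1 - \<nu>\<^sub>3) * level_power (- 1 - \<nu>\<^sub>3) (lev (sd x y))) *
      (P y (- 1 - \<nu>\<^sub>1) * P z (- 1 - \<nu>\<^sub>1) * level_power (- 1 - \<nu>\<^sub>1) (lev (sd y z))) *
      (P z (- 1 - \<nu>\<^sub>2) * P x (- 1 - \<nu>\<^sub>2) * level_power (- 1 - \<nu>\<^sub>2) (lev (sd z x)))"
    unfolding I_integrand_def P_def Let_def prod.case \<nu>[symmetric]
      powr_sd[OF assms(1,2)] powr_sd[OF assms(2,3)] powr_sd[OF assms(3,1)]
      powr_level_power[OF sd_value[OF assms(1,2)]] powr_level_power[OF sd_value[OF assms(2,3)]]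
      powr_level_power[OF sd_value[OF assms(3,1)]] ..
  also have "\<dots> = (P x (- 2 * \<sigma>\<^sub>1) * P x (- 1 - \<nu>\<^sub>3) * P x (- 1 - \<nu>\<^sub>2)) * (P y (- 2 * \<sigma>\<^sub>2) * P y (- 1 - \<nu>\<^sub>3) * P y (- 1 - \<nu>\<^sub>1)) *
      (P z (- 2 * \<sigma>\<^sub>3) * P z (- 1 - \<nu>\<^sub>1) * P z (- 1 - \<nu>\<^sub>2)) *
      triangle_integrand (- 1 - \<nu>\<^sub>1) (- 1 - \<nu>\<^sub>2) (- 1 - \<nu>\<^sub>3) (lev (sd y z), lev (sd z x), lev (sd y x))"
    unfolding sd_commute[OF assms(2,1)]
    by (simp only: triangle_integrand_def fst_conv snd_conv mult_ac)
  finally show ?thesis unfolding P_def psi_powr_combine by (simp add: scaleR_conv_of_real)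
qed

lemma I_tilde_padic_eq:
  "I_tilde_padic p \<mu> \<sigma>\<^sub>1 \<sigma>\<^sub>2 \<sigma>\<^sub>3 = triangle_integral (- 1 - \<nu>\<^sub>3) (- 1 - \<nu>\<^sub>1) (- 1 - \<nu>\<^sub>2)"
  "integrable (\<mu> \<Otimes>\<^sub>M \<mu>) (I_tilde_integrand p \<sigma>\<^sub>1 \<sigma>\<^sub>2 \<sigma>\<^sub>3) \<longleftrightarrow> integrable (count_space UNIV)
    (\<lambda>t. triangle_weight (sphere_mass (1 / real p)) t *\<^sub>R triangle_integrand (- 1 - \<nu>\<^sub>3) (- 1 - \<nu>\<^sub>1) (- 1 - \<nu>\<^sub>2) t)"
proof -
  note L = triangle_integral_levels[OF ultrametric_levels_infinity, of "- 1 - \<nu>\<^sub>3" "- 1 - \<nu>\<^sub>1" "- 1 - \<nu>\<^sub>2"]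
  have eq: "I_tilde_integrand p \<sigma>\<^sub>1 \<sigma>\<^sub>2 \<sigma>\<^sub>3 z = (1 / (psi (fst z))\<^sup>2 * (1 / (psi (snd z))\<^sup>2)) *\<^sub>R
      triangle_integrand (- 1 - \<nu>\<^sub>3) (- 1 - \<nu>\<^sub>1) (- 1 - \<nu>\<^sub>2)
        (lev (sd (fst z) (snd z)), lev (1 / psi (snd z)), lev (1 / psi (fst z)))"
    if "z \<in> space (\<mu> \<Otimes>\<^sub>M \<mu>)" for z
    using that I_tilde_integrand_levels[of "fst z" "snd z"] by (auto simp: space_pair_measure)
  show "I_tilde_padic p \<mu> \<sigma>\<^sub>1 \<sigma>\<^sub>2 \<sigma>\<^sub>3 = triangle_integral (- 1 - \<nu>\<^sub>3) (- 1 - \<nu>\<^sub>1) (- 1 - \<nu>\<^sub>2)"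
    unfolding I_tilde_padic_def L(1)[symmetric] by (rule Bochner_Integration.integral_cong[OF refl eq])
  show "integrable (\<mu> \<Otimes>\<^sub>M \<mu>) (I_tilde_integrand p \<sigma>\<^sub>1 \<sigma>\<^sub>2 \<sigma>\<^sub>3) \<longleftrightarrow> integrable (count_space UNIV)
    (\<lambda>t. triangle_weight (sphere_mass (1 / real p)) t *\<^sub>R triangle_integrand (- 1 - \<nu>\<^sub>3) (- 1 - \<nu>\<^sub>1) (- 1 - \<nu>\<^sub>2) t)"
    unfolding L(2)[symmetric] by (rule Bochner_Integration.integrable_cong[OF refl eq])
qed

text \<open>By Fubini with \<open>x\<^sub>1\<close> outermost, the inner integral is a constant
  times the density of \<open>sm\<close> at \<open>x\<^sub>1\<close>. The constant is the same for
  all \<open>x\<^sub>1\<close>, as every fixed vertex has the same triangle law.\<close>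

lemma I_padic_eq:
  assumes int: "integrable (\<mu> \<Otimes>\<^sub>M \<mu> \<Otimes>\<^sub>M \<mu>) (I_integrand p \<sigma>\<^sub>1 \<sigma>\<^sub>2 \<sigma>\<^sub>3)"
  shows "I_padic p \<mu> \<sigma>\<^sub>1 \<sigma>\<^sub>2 \<sigma>\<^sub>3 = (1 + 1 / of_nat p) * triangle_integral (- 1 - \<nu>\<^sub>3) (- 1 - \<nu>\<^sub>1) (- 1 - \<nu>\<^sub>2)"
proof -
  let ?T = "triangle_integral (- 1 - \<nu>\<^sub>1) (- 1 - \<nu>\<^sub>2) (- 1 - \<nu>\<^sub>3)"
  interpret P: pair_sigma_finite \<mu> "\<mu> \<Otimes>\<^sub>M \<mu>"
    by (intro pair_sigma_finite.intro sigma_finite_pair_measure sigma_finite_measure_axioms)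
  have inner: "(\<integral>z. I_integrand p \<sigma>\<^sub>1 \<sigma>\<^sub>2 \<sigma>\<^sub>3 (x, z) \<partial>(\<mu> \<Otimes>\<^sub>M \<mu>)) = (1 / (psi x)\<^sup>2) *\<^sub>R ?T"
    if x: "x \<in> space \<mu>" for x
  proof -
    have xc: "x \<in> carrier Qp" using x by simp
    note L = triangle_integral_levels(1)[OF ultrametric_levels_point[OF xc], of "- 1 - \<nu>\<^sub>1" "- 1 - \<nu>\<^sub>2" "- 1 - \<nu>\<^sub>3"]
    have "(\<integral>z. I_integrand p \<sigma>\<^sub>1 \<sigma>\<^sub>2 \<sigma>\<^sub>3 (x, z) \<partial>(\<mu> \<Otimes>\<^sub>M \<mu>)) =
        (\<integral>z. (1 / (psi x)\<^sup>2) *\<^sub>R ((1 / (psi (fst z))\<^sup>2 * (1 / (psi (snd z))\<^sup>2)) *\<^sub>R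
          triangle_integrand (- 1 - \<nu>\<^sub>1) (- 1 - \<nu>\<^sub>2) (- 1 - \<nu>\<^sub>3)
            (lev (sd (fst z) (snd z)), lev (sd (snd z) x), lev (sd (fst z) x))) \<partial>(\<mu> \<Otimes>\<^sub>M \<mu>))"
      by (intro Bochner_Integration.integral_cong refl)
         (use xc I_integrand_levels in \<open>auto simp: space_pair_measure\<close>)
    also have "\<dots> = (1 / (psi x)\<^sup>2) *\<^sub>R ?T" unfolding integral_scaleR_right L ..
    finally show ?thesis .
  qed
  have "I_padic p \<mu> \<sigma>\<^sub>1 \<sigma>\<^sub>2 \<sigma>\<^sub>3 = (\<integral>x. (\<integral>z. I_integrand p \<sigma>\<^sub>1 \<sigma>\<^sub>2 \<sigma>\<^sub>3 (x, z) \<partial>(\<mu> \<Otimes>\<^sub>M \<mu>)) \<partial>\<mu>)"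
    unfolding I_padic_def by (rule P.integral_fst'[OF int, symmetric])
  also have "\<dots> = (\<integral>x. (1 / (psi x)\<^sup>2) *\<^sub>R ?T \<partial>\<mu>)"
    by (intro Bochner_Integration.integral_cong refl inner)
  also have "\<dots> = (1 + 1 / of_nat p) * ?T" by (rule integral_inverse_psi_square)
  also have "?T = triangle_integral (- 1 - \<nu>\<^sub>3) (- 1 - \<nu>\<^sub>1) (- 1 - \<nu>\<^sub>2)" by (rule triangle_integral_rotate)
  finally show ?thesis .
qed

end

end

theorem theorem1p9:
  fixes p :: nat and \<mu> :: "padic measure"
    and \<sigma>\<^sub>1 \<sigma>\<^sub>2 \<sigma>\<^sub>3 \<nu>\<^sub>1 \<nu>\<^sub>2 \<nu>\<^sub>3 :: complex
  assumes "prime p"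
    and "normalized_padic_Haar p \<mu>"
    and "\<nu>\<^sub>1 = \<sigma>\<^sub>1 - \<sigma>\<^sub>2 - \<sigma>\<^sub>3"
    and "\<nu>\<^sub>2 = \<sigma>\<^sub>2 - \<sigma>\<^sub>3 - \<sigma>\<^sub>1"
    and "\<nu>\<^sub>3 = \<sigma>\<^sub>3 - \<sigma>\<^sub>1 - \<sigma>\<^sub>2"
    and "integrable (\<mu> \<Otimes>\<^sub>M \<mu> \<Otimes>\<^sub>M \<mu>) (I_integrand p \<sigma>\<^sub>1 \<sigma>\<^sub>2 \<sigma>\<^sub>3)"
    and "integrable (\<mu> \<Otimes>\<^sub>M \<mu>) (I_tilde_integrand p \<sigma>\<^sub>1 \<sigma>\<^sub>2 \<sigma>\<^sub>3)"
  shows "I_padic p \<mu> \<sigma>\<^sub>1 \<sigma>\<^sub>2 \<sigma>\<^sub>3 =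
           1 / padic_Gamma p 2 * I_tilde_padic p \<mu> \<sigma>\<^sub>1 \<sigma>\<^sub>2 \<sigma>\<^sub>3 \<and>
         I_tilde_padic p \<mu> \<sigma>\<^sub>1 \<sigma>\<^sub>2 \<sigma>\<^sub>3 =
           (padic_Gamma p (\<sigma>\<^sub>1 + \<sigma>\<^sub>2 + \<sigma>\<^sub>3 - 1) *
            padic_Gamma p (- \<nu>\<^sub>1) * padic_Gamma p (- \<nu>\<^sub>2) * padic_Gamma p (- \<nu>\<^sub>3)) /
           (padic_Gamma p (2 * \<sigma>\<^sub>1) * padic_Gamma p (2 * \<sigma>\<^sub>2) * padic_Gamma p (2 * \<sigma>\<^sub>3))"
proof
  interpret padic_haar p \<mu> using assms(1,2) by unfold_locales
  define q :: complex where "q = of_nat p"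
  have q: "q \<noteq> 0" "q \<noteq> 1" using p_gt_1 by (auto simp: q_def)
  note tilde = I_tilde_padic_eq[OF assms(3-5)]
  \<comment> \<open>\<open>1 - 1 / q\<^sup>2\<close> factors as
    \<open>(1 - 1 / q) * (1 + 1 / q)\<close>; the quotient is the total mass of
    \<open>sm\<close>.\<close>
  have "1 / padic_Gamma p 2 = 1 + 1 / q"
    using q unfolding inverse_padic_Gamma q_def[symmetric]
    by (simp add: powr_minus powr_numeral field_simps power2_eq_square)
  thus "I_padic p \<mu> \<sigma>\<^sub>1 \<sigma>\<^sub>2 \<sigma>\<^sub>3 = 1 / padic_Gamma p 2 * I_tilde_padic p \<mu> \<sigma>\<^sub>1 \<sigma>\<^sub>2 \<sigma>\<^sub>3"
    unfolding I_padic_eq[OF assms(3-5) assms(6)] tilde(1) q_def by simp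
  define a b c where "a = q powr \<nu>\<^sub>3" "b = q powr \<nu>\<^sub>1" "c = q powr \<nu>\<^sub>2"
  define S where "S = q powr (1 + \<nu>\<^sub>1 + \<nu>\<^sub>2 + \<nu>\<^sub>3)"
  define u where "u = 1 - 1 / q"
  have u: "u \<noteq> 0" using q by (simp add: u_def)
  have I: "I_tilde_padic p \<mu> \<sigma>\<^sub>1 \<sigma>\<^sub>2 \<sigma>\<^sub>3 =
      u * ((1 - a * b) * (1 - b * c) * (1 - c * a)) / ((1 - S) * (1 - a) * (1 - b) * (1 - c))"
    using triangle_integral_value[OF iffD1[OF tilde(2) assms(7)]]
    unfolding tilde(1) a_b_c_def S_def u_def q_def .
  \<comment> \<open>Here \<open>\<nu>\<^sub>2 + \<nu>\<^sub>3 = - 2 * \<sigma>\<^sub>1\<close>, and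
    cyclically.\<close>
  have prods: "q powr (- (2 * \<sigma>\<^sub>1)) = c * a" "q powr (- (2 * \<sigma>\<^sub>2)) = a * b" "q powr (- (2 * \<sigma>\<^sub>3)) = b * c"
    unfolding a_b_c_def powr_add[symmetric] by (simp_all add: assms(3-5))
  have S: "q powr (- (\<sigma>\<^sub>1 + \<sigma>\<^sub>2 + \<sigma>\<^sub>3 - 1)) = S"
    unfolding S_def by (simp add: assms(3-5) algebra_simps)
  show "I_tilde_padic p \<mu> \<sigma>\<^sub>1 \<sigma>\<^sub>2 \<sigma>\<^sub>3 =
      (padic_Gamma p (\<sigma>\<^sub>1 + \<sigma>\<^sub>2 + \<sigma>\<^sub>3 - 1) * padic_Gamma p (- \<nu>\<^sub>1) * padic_Gamma p (- \<nu>\<^sub>2) * padic_Gamma p (- \<nu>\<^sub>3)) /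
      (padic_Gamma p (2 * \<sigma>\<^sub>1) * padic_Gamma p (2 * \<sigma>\<^sub>2) * padic_Gamma p (2 * \<sigma>\<^sub>3))"
    \<comment> \<open>Four Gamma factors over three leave a single \<open>u\<close>, the constant in
      \<open>I\<close>.\<close>
    unfolding I padic_Gamma_def q_def[symmetric] u_def[symmetric] prods S minus_minus a_b_c_def(1-3)[symmetric]
    using u by (simp add: mult_ac)
qed

end
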